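(* Let $f$, $g$, $A\in\mathbb{R}^{p\times m}$, $B\in\mathbb{R}^{p\times n}$, $b\in\mathbb{R}^p$ satisfy either the "smooth case" assumption or the "strongly convex case" assumption (both defined in the context). Consider the (possibly infinite) iterates generated by Algorithm 2 (defined in the context) with tolerance $\varepsilon=0$. Then the sequence of squared residuals $(\|r^k\|^2)_k$ has finite sum. Moreover: In the smooth case: (i) All cluster points $(x,y,z)$ of $(x^k,y^k,z^k)_k$ satisfy the KKT conditions $$-A^\top y\in\partial f(x),\qquad -B^\top y\in\partial g(z),\qquad Ax+Bz=b,$$ and attain the same (finite) cost $f(x)+g(z)$, this being the limit of $(\mathscr L_\beta(x^k,z^k,y^k))_k$. (ii) The sequence $(Ax^k,y^k,Bz^k)_k$ is bounded provided that the cost function $\Phi$ is level bounded. If, additionally, $f\in C^{1,1}(\mathbb{R}^m)$ (differentiable with Lipschitz continuous gradient), then the sequence $(x^k,y^k,z^k)_k$ is bounded. In the strongly convex case: (iii) $\mathscr L_\beta(x^k,z^k,y^k)\nearrow\min\Phi$ as $k\to\infty$, $(Ax^k)_k$ and $(Bz^k)_k$ are convergent, and all the cluster points $(x,y,z)$ of $(x^k,y^k,z^k)_k$ are KKT-optimal triplets, i.e. satisfy $-A^\top y\in\partial f(x)$, $-B^\top y\in\partial g(z)$, $Ax+Bz=b$. (iv) If $b\in\operatorname{int}(A\operatorname{dom}f+B\operatorname{dom}g)$ (equivalently, if the dual cost $\Psi(y):=f^*(-A^\top y)+g^*(-B^\top y)+\langle b,y\rangle$ is level bounded), then $(x^k,y^k,z^k)_k$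 remains bounded.
   Context: The problem is: minimize $f(x)+g(z)$ over $(x,z)\in\mathbb{R}^m\times\mathbb{R}^n$ subject to $Ax+Bz=b$. Set $\Phi(x,z)=f(x)+g(z)$ if $Ax+Bz=b$ and $\Phi(x,z)=\infty$ otherwise; $\min\Phi$ denotes the minimal value of $\Phi$. For a function $h$ on $\mathbb{R}^q$ and a matrix $C\in\mathbb{R}^{p\times q}$, the epicomposition $(Ch)$ is the function on $\mathbb{R}^p$ given by $(Ch)(s)=\inf\{h(x): Cx=s\}$. Smooth case assumption: $f:\mathbb{R}^m\to\mathbb{R}$ and $g:\mathbb{R}^n\to\mathbb{R}\cup\{\infty\}$; $A$ is surjective (full row rank) and $(Af):\mathbb{R}^p\to\mathbb{R}$ has $L_{(Af)}$-Lipschitz continuous gradient; $(Bg):\mathbb{R}^p\to\mathbb{R}\cup\{\infty\}$ is lower semicontinuous (lsc); a solution exists, i.e. $\operatorname{argmin}\Phi\ne\emptyset$. Strongly convex case assumption: $f:\mathbb{R}^m\to\mathbb{R}\cup\{\infty\}$ is lsc, proper and $\mu_f$-strongly convex (i.e. $\mu_f>0$ and $f-\frac{\mu_f}{2}\|\cdot\|^2$ is convex); $g:\mathbb{R}^n\to\mathbb{R}\cup\{\infty\}$ is such that $(Bg):\mathbb{R}^p\to\mathbb{R}\cup\{\infty\}$ is lsc, proper and convex (e.g. when $g$ is proper, convex and level bounded); $b\in\operatorname{relint}(A\operatorname{dom}f+B\operatorname{dom}g)$, where relint denotes the relative interior. Notation: $\operatorname{dom}h=\{x: h(x)<\infty\}$.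 $\hat\partial h$ is the regular subdifferential, i.e. $v\in\hat\partial h(\bar x)$ iff $\liminf_{\bar x\ne x\to\bar x}\frac{h(x)-h(\bar x)-\langle v,x-\bar x\rangle}{\|x-\bar x\|}\ge0$; $\partial h$ is the limiting subdifferential: $v\in\partial h(x)$ iff $x\in\operatorname{dom}h$ and there are $v^k\in\hat\partial h(x^k)$ with $(x^k,h(x^k),v^k)\to(x,h(x),v)$. $h^*(y)=\sup_x\{\langle y,x\rangle-h(x)\}$ is the convex conjugate. A function is level bounded if all its sublevel sets are bounded. Augmented Lagrangian: $\mathscr L_\beta(x,z,y)=f(x)+g(z)+\langle y,Ax+Bz-b\rangle+\frac\beta2\|Ax+Bz-b\|^2$. ADMM oracle: $\mathrm{ADMM}_\beta(\tilde y,\tilde z)$ is the set of $(x,y,z)\in\mathbb{R}^m\times\mathbb{R}^p\times\mathbb{R}^n$ with $x\in\operatorname{argmin}\mathscr L_\beta(\cdot,\tilde z,\tilde y)$, $y=\tilde y+\beta(Ax+B\tilde z-b)$, $z\in\operatorname{argmin}\mathscr L_\beta(x,\cdot,y)$. Constant: $C(\alpha,\lambda)=\frac{\lambda}{(1+\alpha)^2}\bigl(\frac{2-\lambda}{2}-\alpha\,m\bigr)$, where $m=\max\{\alpha-\frac\lambda2,0\}$ if $(Af)$ is convex and $m=1$ otherwise. Algorithm 2 (linesearch ADMM). Inputs: $(x^{-1},y^{-1},z^{-1})\in\mathbb{R}^m\times\mathbb{R}^p\times\mathbb{R}^n$, tolerance $\varepsilon$, relaxation $\lambda\in(0,2)$,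 maximum number of backtracks $i_{\max}\le\infty$. In the smooth case set $\pi=1$, take $\beta>L_{(Af)}$ if $f$ is convex and $\beta>\frac{2L_{(Af)}}{2-\lambda}$ otherwise, and $0<c<C(L_{(Af)}/\beta,\lambda)$. In the strongly convex case set $\pi=-1$, take $0<\beta<\mu_f/\|A\|^2$ and $0<c<C(\beta\|A\|^2/\mu_f,\lambda)$. Initialize $k=0$, $r^{-1}=Ax^{-1}+Bz^{-1}-b$, $y^{-1/2}=y^{-1}-\beta(1-\lambda)r^{-1}$, $(x^0,y^0,z^0)\in\mathrm{ADMM}_\beta(y^{-1/2},z^{-1})$. (1) $r^k=Ax^k+Bz^k-b$; if $\beta\|r^k\|\le\varepsilon$, stop and return $(x^k,y^k,z^k)$. (2) $\bar y^{k+1/2}=y^k-\beta(1-\lambda)r^k$. (3) Select an (arbitrary) update direction $d^k\in\mathbb{R}^p$; set $\tau_k=1$, $i_k=0$. (4) $y^{k+1/2}=(1-\tau_k)\bar y^{k+1/2}+\tau_k\bigl(y^k-\beta(r^k+d^k)\bigr)$. (5) Compute $(x^{k+1},y^{k+1},z^{k+1})\in\mathrm{ADMM}_\beta(y^{k+1/2},z^k)$. (6) If $\pi\mathscr L_\beta(x^{k+1},z^{k+1},y^{k+1})\le\pi\mathscr L_\beta(x^k,z^k,y^k)-\beta c\|r^k\|^2$: $k\leftarrow k+1$ and go to (1). (7) Otherwise, if $i_k=i_{\max}$: take $(x^{k+1},y^{k+1},z^{k+1})\in\mathrm{ADMM}_\beta(\bar y^{k+1/2},z^k)$, $k\leftarrow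 k+1$ and go to (1). (8) Otherwise (backtrack): $\tau_k\leftarrow\tau_k/2$, $i_k\leftarrow i_k+1$ and go to (4).
   Formalization: Cluster-point claims additionally assume f and g lsc in (i) and g lsc in (iii); in (iv), boundedness of z^k additionally assumes that z ↦ max{g(z), ‖Bz‖} is level bounded. Without these assumptions those claims are false. *)

theory Defs
  imports "HOL-Analysis.Analysis"
begin

section \<open>Extended-real-valued functions\<close>

definition edom :: "('a \<Rightarrow> ereal) \<Rightarrow> 'a set" where
  "edom h = {x. h x < \<infinity>}"

definition proper :: "('a \<Rightarrow> ereal) \<Rightarrow> bool" where
  "proper h \<longleftrightarrow> (\<forall>x. h x \<noteq> -\<infinity>) \<and> edom h \<noteq> {}"

definition lsc :: "('a::topological_space \<Rightarrow> ereal) \<Rightarrow> bool" where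
  "lsc h \<longleftrightarrow> (\<forall>x. h x \<le> Liminf (at x) h)"

text \<open>Convexity through the epigraph in \<open>'a \<times> real\<close>: the library's \<open>convex_on\<close> covers
  real-valued functions only.\<close>

definition econvex :: "('a::real_vector \<Rightarrow> ereal) \<Rightarrow> bool" where
  "econvex h \<longleftrightarrow> convex {(x, t::real). h x \<le> ereal t}"

definition strongly_convex :: "real \<Rightarrow> ('a::real_normed_vector \<Rightarrow> ereal) \<Rightarrow> bool" where
  "strongly_convex \<mu> h \<longleftrightarrow> \<mu> > 0 \<and> econvex (\<lambda>x. h x - ereal (\<mu> / 2 * (norm x)\<^sup>2))"

definition level_bounded :: "('a::metric_space \<Rightarrow> ereal) \<Rightarrow> bool" where
  "level_bounded h \<longleftrightarrow> (\<forall>a::real. bounded {x. h x \<le> ereal a})"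

text \<open>As usual, a function that is identically \<open>\<infinity>\<close> has no minimizers.\<close>

definition argmin :: "('a \<Rightarrow> ereal) \<Rightarrow> 'a set" where
  "argmin h = {x. h x < \<infinity> \<and> (\<forall>x'. h x \<le> h x')}"

definition lipschitz_gradient :: "real \<Rightarrow> ('a::real_inner \<Rightarrow> ereal) \<Rightarrow> bool" where
  "lipschitz_gradient L h \<longleftrightarrow> (\<forall>x. \<bar>h x\<bar> \<noteq> \<infinity>) \<and>
     (\<exists>G. (\<forall>x. GDERIV (\<lambda>x. real_of_ereal (h x)) x :> G x) \<and> L-lipschitz_on UNIV G)"

definition fenchel :: "('a::real_inner \<Rightarrow> ereal) \<Rightarrow> 'a \<Rightarrow> ereal" where
  "fenchel h y = (SUP x. ereal (y \<bullet> x) - h x)"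

definition epicomp :: "real^'q^'p \<Rightarrow> (real^'q \<Rightarrow> ereal) \<Rightarrow> real^'p \<Rightarrow> ereal" where
  "epicomp C h s = (INF x \<in> {x. C *v x = s}. h x)"

definition regular_subdiff :: "('a::real_inner \<Rightarrow> ereal) \<Rightarrow> 'a \<Rightarrow> 'a set" where
  "regular_subdiff h x = {v. \<bar>h x\<bar> \<noteq> \<infinity> \<and>
     0 \<le> Liminf (at x) (\<lambda>x'. (h x' - h x - ereal (v \<bullet> (x' - x))) / ereal (norm (x' - x)))}"

definition limiting_subdiff :: "('a::real_inner \<Rightarrow> ereal) \<Rightarrow> 'a \<Rightarrow> 'a set" where
  "limiting_subdiff h x = {v. x \<in> edom h \<and>
     (\<exists>X V. (\<forall>k. V k \<in> regular_subdiff h (X k)) \<and>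
        X \<longlonglongrightarrow> x \<and> (\<lambda>k. h (X k)) \<longlonglongrightarrow> h x \<and> V \<longlonglongrightarrow> v)}"

definition cluster_point :: "(nat \<Rightarrow> 'a::topological_space) \<Rightarrow> 'a \<Rightarrow> bool" where
  "cluster_point X p \<longleftrightarrow> (\<exists>\<phi>::nat \<Rightarrow> nat. strict_mono \<phi> \<and> (X \<circ> \<phi>) \<longlonglongrightarrow> p)"


section \<open>The problem and its assumptions\<close>

definition resid :: "real^'m^'p \<Rightarrow> real^'n^'p \<Rightarrow> real^'p \<Rightarrow> real^'m \<Rightarrow> real^'n \<Rightarrow> real^'p" where
  "resid A B b x z = A *v x + B *v z - b"

definition cost :: "(real^'m \<Rightarrow> ereal) \<Rightarrow> (real^'n \<Rightarrow> ereal) \<Rightarrow> real^'m^'p \<Rightarrow> real^'n^'p \<Rightarrow> real^'p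
    \<Rightarrow> (real^'m) \<times> (real^'n) \<Rightarrow> ereal" where
  "cost f g A B b = (\<lambda>(x, z). if A *v x + B *v z = b then f x + g z else \<infinity>)"

definition dual_cost :: "(real^'m \<Rightarrow> ereal) \<Rightarrow> (real^'n \<Rightarrow> ereal) \<Rightarrow> real^'m^'p \<Rightarrow> real^'n^'p \<Rightarrow> real^'p
    \<Rightarrow> real^'p \<Rightarrow> ereal" where
  "dual_cost f g A B b y =
     fenchel f (- (transpose A *v y)) + fenchel g (- (transpose B *v y)) + ereal (b \<bullet> y)"

definition kkt :: "(real^'m \<Rightarrow> ereal) \<Rightarrow> (real^'n \<Rightarrow> ereal) \<Rightarrow> real^'m^'p \<Rightarrow> real^'n^'p \<Rightarrow> real^'p
    \<Rightarrow> real^'m \<Rightarrow> real^'p \<Rightarrow> real^'n \<Rightarrow> bool" where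
  "kkt f g A B b x y z \<longleftrightarrow>
     - (transpose A *v y) \<in> limiting_subdiff f x \<and>
     - (transpose B *v y) \<in> limiting_subdiff g z \<and>
     A *v x + B *v z = b"

definition image_dom_sum :: "(real^'m \<Rightarrow> ereal) \<Rightarrow> (real^'n \<Rightarrow> ereal) \<Rightarrow> real^'m^'p \<Rightarrow> real^'n^'p
    \<Rightarrow> (real^'p) set" where
  "image_dom_sum f g A B = {A *v x + B *v z | x z. x \<in> edom f \<and> z \<in> edom g}"

definition smooth_case :: "(real^'m \<Rightarrow> ereal) \<Rightarrow> (real^'n \<Rightarrow> ereal) \<Rightarrow> real^'m^'p \<Rightarrow> real^'n^'p \<Rightarrow> real^'p
    \<Rightarrow> real \<Rightarrow> bool" where
  "smooth_case f g A B b L \<longleftrightarrow>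
     (\<forall>x. \<bar>f x\<bar> \<noteq> \<infinity>) \<and> (\<forall>z. g z \<noteq> -\<infinity>) \<and>
     surj ((*v) A) \<and> lipschitz_gradient L (epicomp A f) \<and>
     (\<forall>s. epicomp B g s \<noteq> -\<infinity>) \<and> lsc (epicomp B g) \<and>
     argmin (cost f g A B b) \<noteq> {}"

definition strongly_convex_case :: "(real^'m \<Rightarrow> ereal) \<Rightarrow> (real^'n \<Rightarrow> ereal) \<Rightarrow> real^'m^'p \<Rightarrow> real^'n^'p \<Rightarrow> real^'p
    \<Rightarrow> real \<Rightarrow> bool" where
  "strongly_convex_case f g A B b \<mu> \<longleftrightarrow>
     lsc f \<and> proper f \<and> strongly_convex \<mu> f \<and>
     (\<forall>z. g z \<noteq> -\<infinity>) \<and>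
     lsc (epicomp B g) \<and> proper (epicomp B g) \<and> econvex (epicomp B g) \<and>
     b \<in> rel_interior (image_dom_sum f g A B)"


section \<open>ADMM with linesearch\<close>

definition aug_lag :: "(real^'m \<Rightarrow> ereal) \<Rightarrow> (real^'n \<Rightarrow> ereal) \<Rightarrow> real^'m^'p \<Rightarrow> real^'n^'p \<Rightarrow> real^'p \<Rightarrow> real
    \<Rightarrow> real^'m \<Rightarrow> real^'n \<Rightarrow> real^'p \<Rightarrow> ereal" where
  "aug_lag f g A B b \<beta> x z y =
     f x + g z + ereal (y \<bullet> resid A B b x z + \<beta> / 2 * (norm (resid A B b x z))\<^sup>2)"

text \<open>In the \<open>x\<close>-step the term \<open>g zt\<close> of the augmented Lagrangian is constant and is left out
  (\<open>g\<close> is replaced by \<open>0\<close>). This changes nothing if \<open>g zt\<close> is finite, see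
  \<open>argmin_aug_lag_x\<close> below; it gives the \<open>x\<close>-step its intended meaning also at a starting
  point \<open>zt\<close> outside the domain of \<open>g\<close>, where the augmented Lagrangian itself is constantly
  \<open>\<infinity>\<close> in \<open>x\<close>.\<close>

definition admm :: "(real^'m \<Rightarrow> ereal) \<Rightarrow> (real^'n \<Rightarrow> ereal) \<Rightarrow> real^'m^'p \<Rightarrow> real^'n^'p \<Rightarrow> real^'p \<Rightarrow> real
    \<Rightarrow> real^'p \<Rightarrow> real^'n \<Rightarrow> ((real^'m) \<times> (real^'p) \<times> (real^'n)) set" where
  "admm f g A B b \<beta> yt zt = {(x, y, z).
     x \<in> argmin (\<lambda>x'. aug_lag f (\<lambda>_. 0) A B b \<beta> x' zt yt) \<and>
     y = yt + \<beta> *\<^sub>R (A *v x + B *v zt - b) \<and>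
     z \<in> argmin (\<lambda>z'. aug_lag f g A B b \<beta> x z' y)}"

lemma argmin_aug_lag_x:
  assumes "\<bar>g zt\<bar> \<noteq> \<infinity>"
  shows "argmin (\<lambda>x. aug_lag f g A B b \<beta> x zt yt) =
         argmin (\<lambda>x. aug_lag f (\<lambda>_. 0) A B b \<beta> x zt yt)"
proof -
  obtain c where c: "g zt = ereal c" using assms by auto
  have eq: "aug_lag f g A B b \<beta> x zt yt = aug_lag f (\<lambda>_. 0) A B b \<beta> x zt yt + ereal c" for x
    by (simp add: aug_lag_def c ac_simps)
  have le: "u + ereal c \<le> v + ereal c \<longleftrightarrow> u \<le> v" for u v
    by (cases u; cases v) auto
  have lt: "u + ereal c < \<infinity> \<longleftrightarrow> u < \<infinity>" for u
    by (cases u) auto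
  show ?thesis unfolding argmin_def eq le lt ..
qed

definition admm_const :: "real^'m^'p \<Rightarrow> (real^'m \<Rightarrow> ereal) \<Rightarrow> real \<Rightarrow> real \<Rightarrow> real" where
  "admm_const A f \<alpha> lam = lam / (1 + \<alpha>)\<^sup>2 *
     ((2 - lam) / 2 - \<alpha> * (if econvex (epicomp A f) then max (\<alpha> - lam / 2) 0 else 1))"

definition smooth_params :: "(real^'m \<Rightarrow> ereal) \<Rightarrow> real^'m^'p \<Rightarrow> real \<Rightarrow> real \<Rightarrow> real \<Rightarrow> real \<Rightarrow> bool" where
  "smooth_params f A L lam \<beta> c \<longleftrightarrow>
     0 < lam \<and> lam < 2 \<and>
     (if econvex f then \<beta> > L else \<beta> > 2 * L / (2 - lam)) \<and>
     0 < c \<and> c < admm_const A f (L / \<beta>) lam"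

text \<open>The bound \<open>\<beta> < \<mu> / \<parallel>A\<parallel>\<^sup>2\<close> is multiplied out, so that \<open>A = 0\<close> puts no upper bound on
  \<open>\<beta>\<close>.\<close>

definition strongly_convex_params :: "(real^'m \<Rightarrow> ereal) \<Rightarrow> real^'m^'p \<Rightarrow> real \<Rightarrow> real \<Rightarrow> real \<Rightarrow> real \<Rightarrow> bool" where
  "strongly_convex_params f A \<mu> lam \<beta> c \<longleftrightarrow>
     0 < lam \<and> lam < 2 \<and>
     0 < \<beta> \<and> \<beta> * (onorm ((*v) A))\<^sup>2 < \<mu> \<and>
     0 < c \<and> c < admm_const A f (\<beta> * (onorm ((*v) A))\<^sup>2 / \<mu>) lam"

definition ls_accept :: "(real^'m \<Rightarrow> ereal) \<Rightarrow> (real^'n \<Rightarrow> ereal) \<Rightarrow> real^'m^'p \<Rightarrow> real^'n^'p \<Rightarrow> real^'p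
    \<Rightarrow> real \<Rightarrow> real \<Rightarrow> real \<Rightarrow> (real^'m) \<times> (real^'p) \<times> (real^'n)
    \<Rightarrow> (real^'m) \<times> (real^'p) \<times> (real^'n) \<Rightarrow> bool" where
  "ls_accept f g A B b \<pi> \<beta> c = (\<lambda>(x, y, z) (x', y', z').
     ereal \<pi> * aug_lag f g A B b \<beta> x' z' y' \<le>
     ereal \<pi> * aug_lag f g A B b \<beta> x z y - ereal (\<beta> * c * (norm (resid A B b x z))\<^sup>2))"

text \<open>One iteration, for a current triplet with nonzero residual. Here \<open>d\<close> is the update
  direction, \<open>w j\<close> is the trial triplet for the stepsize \<open>1 / 2 ^ j\<close>, and \<open>i\<close> is the final
  number of backtracks; if the trial \<open>w i\<close> is also rejected, \<open>i\<close> is the maximum number of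
  backtracks and the nominal step is taken instead.\<close>

definition ls_step :: "(real^'m \<Rightarrow> ereal) \<Rightarrow> (real^'n \<Rightarrow> ereal) \<Rightarrow> real^'m^'p \<Rightarrow> real^'n^'p \<Rightarrow> real^'p
    \<Rightarrow> real \<Rightarrow> real \<Rightarrow> real \<Rightarrow> real \<Rightarrow> enat
    \<Rightarrow> (real^'m) \<times> (real^'p) \<times> (real^'n) \<Rightarrow> (real^'m) \<times> (real^'p) \<times> (real^'n) \<Rightarrow> bool" where
  "ls_step f g A B b \<pi> lam \<beta> c imax = (\<lambda>(x, y, z) next_w.
     let r = resid A B b x z;
         ybar = y - (\<beta> * (1 - lam)) *\<^sub>R r;
         accepted = ls_accept f g A B b \<pi> \<beta> c (x, y, z)
     in \<exists>d i w.
          (\<forall>j\<le>i. w j \<in> admm f g A B b \<beta>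
             ((1 - 1 / 2 ^ j) *\<^sub>R ybar + (1 / 2 ^ j) *\<^sub>R (y - \<beta> *\<^sub>R (r + d))) z) \<and>
          (\<forall>j<i. \<not> accepted (w j)) \<and>
          enat i \<le> imax \<and>
          (if accepted (w i) then next_w = w i
           else enat i = imax \<and> next_w \<in> admm f g A B b \<beta> ybar z))"

text \<open>The sequences \<open>x\<close>, \<open>y\<close>, \<open>z\<close> are iterates of the algorithm started at
  \<open>(xm, ym, zm)\<close> (the triplet with index \<open>-1\<close>). A run that stops at iteration \<open>k\<close> is represented
  by sequences that are constant from index \<open>k\<close> on.\<close>

definition ls_admm_run :: "(real^'m \<Rightarrow> ereal) \<Rightarrow> (real^'n \<Rightarrow> ereal) \<Rightarrow> real^'m^'p \<Rightarrow> real^'n^'p \<Rightarrow> real^'p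
    \<Rightarrow> real \<Rightarrow> real \<Rightarrow> real \<Rightarrow> real \<Rightarrow> enat \<Rightarrow> real
    \<Rightarrow> real^'m \<Rightarrow> real^'p \<Rightarrow> real^'n
    \<Rightarrow> (nat \<Rightarrow> real^'m) \<Rightarrow> (nat \<Rightarrow> real^'p) \<Rightarrow> (nat \<Rightarrow> real^'n) \<Rightarrow> bool" where
  "ls_admm_run f g A B b \<pi> lam \<beta> c imax \<epsilon> xm ym zm x y z \<longleftrightarrow>
     (x 0, y 0, z 0) \<in> admm f g A B b \<beta> (ym - (\<beta> * (1 - lam)) *\<^sub>R resid A B b xm zm) zm \<and>
     (\<forall>k. if \<beta> * norm (resid A B b (x k) (z k)) \<le> \<epsilon>
          then (x (Suc k), y (Suc k), z (Suc k)) = (x k, y k, z k)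
          else ls_step f g A B b \<pi> lam \<beta> c imax
                 (x k, y k, z k) (x (Suc k), y (Suc k), z (Suc k)))"

end

theory Submission
  imports Defs
begin

text \<open>
  Both cases are the same Douglas-Rachford descent in different coordinates. Write
  \<open>r = A x + B z - b\<close>. In the smooth case put \<open>u = A x\<close>, \<open>w = b - B z\<close>, \<open>P = (Af)\<close>; optimality of
  the \<open>x\<close>-step says \<open>\<nabla>P u = - y\<close>, so the augmented Lagrangian is
  \<open>P u + \<nabla>P u \<bullet> (w - u) + \<beta>/2 |w - u|\<^sup>2 + (Bg)(b - w)\<close>, minimized over \<open>w\<close> by the \<open>z\<close>-step. In the
  strongly convex case put \<open>u = y\<close>, \<open>w = y + \<beta> r\<close> and let \<open>P\<close> be the dual function
  \<open>y \<mapsto> f\<^sup>*(- A\<^sup>T y)\<close>, whose gradient at \<open>y\<close> is \<open>- A x\<close> and is Lipschitz with constant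
  \<open>|A|\<^sup>2 / \<mu>\<close>. Minus the augmented Lagrangian then is the same expression, with
  \<open>1 / \<beta>\<close> for \<open>\<beta>\<close> and the dual function \<open>w \<mapsto> g\<^sup>*(- B\<^sup>T w) + b \<bullet> w\<close> as its last term.
  In both readings a nominal step moves \<open>u + \<nabla>P u / \<beta>\<close> by \<open>\<lambda> (w - u)\<close>, and a single estimate
  (\<open>douglas_rachford_decrease\<close>) shows that it changes the augmented Lagrangian by at least
  \<open>\<beta> c |r|\<^sup>2\<close> in the good direction. The linesearch accepts other steps only if they do as well,
  so the Lagrangian is monotone along every run, whatever the update directions are. As it is
  bounded on the relevant side by the optimal value, the squared residuals are summable.

  Every ADMM triplet satisfies two exact optimality conditions with quadratic remainder
  (\<open>quad_min\<close>): one for \<open>x\<close> with multiplier \<open>y\<close>, one for \<open>z\<close> with multiplier \<open>y + \<beta> r\<close>. They give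
  regular subgradients, and they survive limits together with the function values
  (\<open>quad_min_limit\<close>). With \<open>r \<rightarrow> 0\<close> this yields the KKT conditions at cluster points.

  In the smooth case the Lagrangian dominates the least cost of feasible points with the same \<open>z\<close>
  (\<open>value_le_lag\<close>). This bounds it from below, and it bounds the iterates if the cost is level
  bounded.

  In the strongly convex case the conditions for \<open>x\<close> and \<open>z\<close> become global and add up to
  \<open>f x' + (Bg) v \<ge> L + \<kappa>/2 |x' - x|\<^sup>2 - (y + \<beta> r) \<bullet> (A x' + v - b)\<close> with \<open>\<kappa> = \<mu> - \<beta> |A|\<^sup>2 > 0\<close>,
  where \<open>L\<close> is the augmented Lagrangian at \<open>(x, y, z)\<close> (\<open>lag_growth\<close>). Feasible points show that
  \<open>L\<close> is at most the optimal value. For the converse, the relative interior condition gives a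
  uniform bound on the perturbed problems \<open>A x' + v = b + e\<close> for small admissible \<open>e\<close>. Perturbing
  along \<open>\<plusminus>r\<close> controls the multiplier in the direction of the residual, and joining an
  infeasible iterate to a point on the other side of \<open>b\<close> produces feasible points whose value
  exceeds the Lagrangian by an amount that vanishes with \<open>r\<close> (\<open>lag_tendsto_opt\<close>). The quadratic term
  of \<open>lag_growth\<close> then makes \<open>x\<close> a Cauchy sequence. If \<open>b\<close> is an interior point, all directions
  \<open>e\<close> are admissible, which bounds the multipliers and the level sets of the dual cost; if not,
  the dual cost is bounded above along a line.
\<close>

section \<open>Perturbed minimizers of convex and lower semicontinuous functions\<close>

text \<open>The defining inequality of strong convexity, recovered from convexity of the epigraph of
  \<open>h - \<sigma>/2 |.|\<^sup>2\<close>: the segment between two epigraph points, shifted back by the squared norm.\<close>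

lemma strongly_convex_segment:
  fixes h :: "'a::real_inner \<Rightarrow> ereal"
  assumes cvx: "econvex (\<lambda>x. h x - ereal (\<sigma> / 2 * (norm x)\<^sup>2))"
    and x: "h x \<le> ereal a" and x': "h x' \<le> ereal a'" and t: "0 \<le> t" "t \<le> 1"
  shows "h ((1 - t) *\<^sub>R x + t *\<^sub>R x')
    \<le> ereal ((1 - t) * a + t * a' - \<sigma> / 2 * (t * (1 - t) * (norm (x' - x))\<^sup>2))"
proof -
  define p where "p = (1 - t) *\<^sub>R x + t *\<^sub>R x'"
  let ?S = "{(x, s::real). h x - ereal (\<sigma> / 2 * (norm x)\<^sup>2) \<le> ereal s}"
  have shift: "u \<le> ereal s \<Longrightarrow> u - ereal q \<le> ereal (s - q)" for u and s q :: real
    by (cases u) auto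
  have unshift: "u - ereal q \<le> ereal s \<Longrightarrow> u \<le> ereal (s + q)" for u and s q :: real
    by (cases u) auto
  have "(x, a - \<sigma> / 2 * (norm x)\<^sup>2) \<in> ?S" "(x', a' - \<sigma> / 2 * (norm x')\<^sup>2) \<in> ?S"
    using shift x x' by auto
  then have "(1 - t) *\<^sub>R (x, a - \<sigma> / 2 * (norm x)\<^sup>2) + t *\<^sub>R (x', a' - \<sigma> / 2 * (norm x')\<^sup>2) \<in> ?S"
    using cvx t unfolding econvex_def by (intro convexD) auto
  then have *: "h p \<le> ereal ((1 - t) * (a - \<sigma> / 2 * (norm x)\<^sup>2)
      + t * (a' - \<sigma> / 2 * (norm x')\<^sup>2) + \<sigma> / 2 * (norm p)\<^sup>2)"
    by (auto simp: p_def dest!: unshift)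
  have norm_p: "(norm p)\<^sup>2 = (1 - t) * (norm x)\<^sup>2 + t * (norm x')\<^sup>2 - t * (1 - t) * (norm (x' - x))\<^sup>2"
    unfolding p_def power2_norm_eq_inner
    by (simp add: inner_simps inner_commute algebra_simps power2_eq_square)
  show ?thesis
    using *[unfolded norm_p] unfolding p_def[symmetric] by (simp add: algebra_simps diff_divide_distrib)
qed

lemma strongly_convex_imp_econvex:
  fixes h :: "'a::real_inner \<Rightarrow> ereal"
  assumes cvx: "econvex (\<lambda>x. h x - ereal (\<sigma> / 2 * (norm x)\<^sup>2))" and "\<sigma> \<ge> 0"
  shows "econvex h"
  unfolding econvex_def
proof (rule convexI)
  fix q q' :: "'a \<times> real" and u v :: real
  assume "q \<in> {(x, s). h x \<le> ereal s}" "q' \<in> {(x, s). h x \<le> ereal s}"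
    and uv: "0 \<le> u" "0 \<le> v" "u + v = 1"
  then obtain x a x' a' where q: "q = (x, a)" "q' = (x', a')"
    and h: "h x \<le> ereal a" "h x' \<le> ereal a'"
    by auto
  have u: "u = 1 - v" using uv by simp
  have "0 \<le> \<sigma> / 2 * (v * (1 - v) * (norm (x' - x))\<^sup>2)"
    using uv \<open>\<sigma> \<ge> 0\<close> by (auto intro!: mult_nonneg_nonneg)
  then have "h ((1 - v) *\<^sub>R x + v *\<^sub>R x') \<le> ereal ((1 - v) * a + v * a')"
    using strongly_convex_segment[OF cvx h, of v] uv by (auto elim!: order_trans)
  then show "u *\<^sub>R q + v *\<^sub>R q' \<in> {(x, s). h x \<le> ereal s}"
    by (simp add: u q)
qed

lemma le_if_le_add_small:
  fixes u v w :: real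
  assumes "\<And>t. 0 < t \<Longrightarrow> t < 1 \<Longrightarrow> u \<le> v + t * w"
  shows "u \<le> v"
proof (rule tendsto_lowerbound)
  show "((\<lambda>t. v + t * w) \<longlongrightarrow> v) (at_right 0)"
    by (auto intro!: tendsto_eq_intros)
  show "\<forall>\<^sub>F t in at_right 0. u \<le> v + t * w"
    by (rule eventually_at_rightI[of 0 1]) (use assms in auto)
qed simp

text \<open>A quadratic perturbation is invisible to first order: along the segment from \<open>x\<close> to \<open>x'\<close> it
  contributes \<open>t\<^sup>2\<close>, while convexity gains a term of order \<open>t\<close>. So the remainder \<open>K\<close> disappears, and
  the growth \<open>\<sigma>/2\<close> takes its place. With \<open>\<sigma> = 0\<close> this is the gradient inequality of a convex
  function.\<close>

lemma growth_of_perturbed_min: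
  fixes h :: "'a::real_inner \<Rightarrow> ereal"
  assumes cvx: "econvex (\<lambda>x. h x - ereal (\<sigma> / 2 * (norm x)\<^sup>2))"
    and x: "h x = ereal a" and x': "h x' = ereal a'"
    and min: "\<And>s. h x \<le> h s + ereal (\<eta> \<bullet> (s - x) + K * (norm (s - x))\<^sup>2)"
  shows "a + \<sigma> / 2 * (norm (x' - x))\<^sup>2 \<le> a' + \<eta> \<bullet> (x' - x)"
proof (rule le_if_le_add_small)
  fix t :: real
  assume t: "0 < t" "t < 1"
  define D where "D = (norm (x' - x))\<^sup>2"
  define p where "p = (1 - t) *\<^sub>R x + t *\<^sub>R x'"
  have p: "p - x = t *\<^sub>R (x' - x)"
    by (simp add: p_def algebra_simps)
  have "ereal a \<le> h p + ereal (\<eta> \<bullet> (p - x) + K * (norm (p - x))\<^sup>2)"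
    using min[of p] x by simp
  also have "\<dots> \<le> ereal ((1 - t) * a + t * a' - \<sigma> / 2 * (t * (1 - t) * D))
       + ereal (t * (\<eta> \<bullet> (x' - x)) + K * (t\<^sup>2 * D))"
    using strongly_convex_segment[OF cvx, of x a x' a' t] t x x'
    unfolding p unfolding p_def D_def by (intro add_mono) (auto simp: power_mult_distrib)
  finally have "a \<le> (1 - t) * a + t * a' - \<sigma> / 2 * (t * (1 - t) * D)
      + (t * (\<eta> \<bullet> (x' - x)) + K * (t\<^sup>2 * D))"
    by simp
  moreover have "(1 - t) * a + t * a' - \<sigma> / 2 * (t * (1 - t) * D)
      + (t * (\<eta> \<bullet> (x' - x)) + K * (t\<^sup>2 * D))
    = a - t * a + t * (a' - \<sigma> / 2 * ((1 - t) * D) + \<eta> \<bullet> (x' - x) + K * (t * D))"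
    by (simp add: algebra_simps power2_eq_square diff_divide_distrib)
  ultimately have "t * a \<le> t * (a' - \<sigma> / 2 * ((1 - t) * D) + \<eta> \<bullet> (x' - x) + K * (t * D))"
    by linarith
  then have "a \<le> a' - \<sigma> / 2 * ((1 - t) * D) + \<eta> \<bullet> (x' - x) + K * (t * D)"
    using t by simp
  then show "a + \<sigma> / 2 * (norm (x' - x))\<^sup>2
      \<le> a' + \<eta> \<bullet> (x' - x) + t * (\<sigma> / 2 * D + K * D)"
    unfolding D_def[symmetric] by (simp add: algebra_simps diff_divide_distrib)
qed

text \<open>The optimality condition of an ADMM subproblem, with the quadratic objective expanded around
  its own minimizer \<open>x\<close>; \<open>\<eta>\<close> is then the multiplier after the update.\<close>

definition quad_min :: "(real^'q \<Rightarrow> ereal) \<Rightarrow> real^'q^'p \<Rightarrow> real^'p \<Rightarrow> real \<Rightarrow> real^'q \<Rightarrow> bool" where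
  "quad_min h C \<eta> \<beta> x \<longleftrightarrow> \<bar>h x\<bar> \<noteq> \<infinity> \<and>
     (\<forall>x'. h x \<le> h x' + ereal (\<eta> \<bullet> (C *v x' - C *v x) + \<beta> / 2 * (norm (C *v x' - C *v x))\<^sup>2))"

lemma transpose_inner: "(transpose C *v \<eta>) \<bullet> d = \<eta> \<bullet> (C *v d)" for C :: "real^'q^'p"
  by (simp add: dot_lmul_matrix)

lemma norm_mult_vec_le: "norm (C *v d) \<le> onorm ((*v) C) * norm d" for C :: "real^'q^'p"
  by (rule onorm) (rule matrix_vector_mul_bounded_linear)

lemma quad_min_regular_subdiff:
  assumes min: "quad_min h C \<eta> \<beta> x" and "\<beta> \<ge> 0"
  shows "- (transpose C *v \<eta>) \<in> regular_subdiff h x"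
proof -
  define K where "K = onorm ((*v) C)"
  obtain a where a: "h x = ereal a"
    using min by (auto simp: quad_min_def)
  let ?q = "\<lambda>x'. (h x' - h x - ereal (- (transpose C *v \<eta>) \<bullet> (x' - x))) / ereal (norm (x' - x))"
  let ?l = "\<lambda>x'. ereal (- (\<beta> / 2 * K\<^sup>2) * norm (x' - x))"
  have "?l x' \<le> ?q x'" if "x' \<noteq> x" for x'
  proof -
    define d where "d = x' - x"
    have d: "norm d > 0" using that by (simp add: d_def)
    have m: "ereal a \<le> h x' + ereal (\<eta> \<bullet> (C *v d) + \<beta> / 2 * (norm (C *v d))\<^sup>2)"
      using min by (simp add: quad_min_def a d_def matrix_vector_mult_diff_distrib)
    have le: "\<beta> / 2 * (norm (C *v d))\<^sup>2 \<le> \<beta> / 2 * (K * norm d)\<^sup>2"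
      unfolding K_def using norm_mult_vec_le[of C d] \<open>\<beta> \<ge> 0\<close>
      by (intro mult_left_mono power_mono) auto
    show ?thesis
    proof (cases "h x'")
      case (real a')
      have "- (\<beta> / 2 * K\<^sup>2) * norm d * norm d \<le> a' - a + \<eta> \<bullet> (C *v d)"
        using m real le by (simp add: power2_eq_square algebra_simps)
      then have "- (\<beta> / 2 * K\<^sup>2) * norm d \<le> (a' - a + \<eta> \<bullet> (C *v d)) / norm d"
        using d by (simp add: pos_le_divide_eq)
      then show ?thesis
        using d by (simp add: real a transpose_inner flip: d_def del: transpose_matrix_vector)
    next
      case PInf
      then show ?thesis using d by (simp add: a flip: d_def)
    next
      case MInf
      then show ?thesis using m by simp
    qed
  qed
  then have "Liminf (at x) ?l \<le> Liminf (at x) ?q"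
    by (intro Liminf_mono) (auto simp: eventually_at_filter)
  moreover have "Liminf (at x) ?l = 0"
  proof (rule lim_imp_Liminf)
    have "((\<lambda>x'. - (\<beta> / 2 * K\<^sup>2) * norm (x' - x)) \<longlongrightarrow> - (\<beta> / 2 * K\<^sup>2) * norm (x - x)) (at x)"
      by (intro tendsto_intros)
    then show "(?l \<longlongrightarrow> 0) (at x)"
      by (simp add: zero_ereal_def)
  qed simp
  ultimately show ?thesis
    using a by (simp add: regular_subdiff_def)
qed

lemma lsc_eventually_gt:
  fixes h :: "'a::topological_space \<Rightarrow> ereal"
  assumes "lsc h" "(X \<longlongrightarrow> x) F" "y < h x"
  shows "\<forall>\<^sub>F k in F. y < h (X k)"
proof -
  have "y < Liminf (at x) h"
    using assms unfolding lsc_def by (metis less_le_trans)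
  then have "\<forall>\<^sub>F s in at x. y < h s"
    by (rule less_LiminfD)
  then have "\<forall>\<^sub>F s in nhds x. y < h s"
    using assms(3) by (auto simp: eventually_at_filter elim: eventually_mono)
  then show ?thesis
    using assms(2) by (rule eventually_compose_filterlim)
qed

text \<open>Lower semicontinuity bounds the limit inferior of the values from below, and the optimality
  conditions tested at \<open>x\<close> bound the limit superior from above. Testing at the first iterate
  shows that the limit point lies in the domain at all.\<close>

lemma quad_min_limit:
  fixes h :: "real^'q \<Rightarrow> ereal" and C :: "real^'q^'p"
  assumes lsc: "lsc h" and bot: "\<And>s. h s \<noteq> -\<infinity>" and X: "X \<longlonglongrightarrow> x" and E: "E \<longlonglongrightarrow> \<eta>"
    and min: "\<And>k. quad_min h C (E k) \<beta> (X k)" and "\<beta> \<ge> 0"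
  shows "(\<lambda>k. h (X k)) \<longlonglongrightarrow> h x" "\<bar>h x\<bar> \<noteq> \<infinity>" "- (transpose C *v \<eta>) \<in> limiting_subdiff h x"
proof -
  define e where "e k s = E k \<bullet> (C *v s - C *v X k) + \<beta> / 2 * (norm (C *v s - C *v X k))\<^sup>2" for k s
  have le: "h (X k) \<le> h s + ereal (e k s)" for k s
    using min[of k] by (simp add: quad_min_def e_def)
  have e: "(\<lambda>k. e k s) \<longlonglongrightarrow> \<eta> \<bullet> (C *v s - C *v x) + \<beta> / 2 * (norm (C *v s - C *v x))\<^sup>2" for s
    unfolding e_def
    by (intro tendsto_intros E bounded_linear.tendsto[OF matrix_vector_mul_bounded_linear X])
  obtain a where a: "h (X 0) = ereal a"
    using min[of 0] by (auto simp: quad_min_def)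
  have "Bseq (\<lambda>k. e k (X 0))"
    using e[of "X 0"] by (intro convergent_imp_Bseq convergentI)
  then obtain K where K: "\<And>k. e k (X 0) \<le> K"
    unfolding Bseq_def by (auto simp: abs_le_iff)
  have "h x \<le> ereal (a + K)"
  proof (rule ccontr)
    assume "\<not> h x \<le> ereal (a + K)"
    then have "\<forall>\<^sub>F k in sequentially. ereal (a + K) < h (X k)"
      by (intro lsc_eventually_gt[OF lsc X]) simp
    then obtain k where "ereal (a + K) < h (X k)"
      using eventually_happens'[OF sequentially_bot] by blast
    moreover have "h (X k) \<le> ereal (a + K)"
      using le[of k "X 0"] K[of k] a by (auto elim!: order_trans)
    ultimately show False by simp
  qed
  then show fin: "\<bar>h x\<bar> \<noteq> \<infinity>"
    using bot[of x] by auto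
  then obtain \<alpha> where \<alpha>: "h x = ereal \<alpha>" by auto
  show conv: "(\<lambda>k. h (X k)) \<longlonglongrightarrow> h x"
  proof (rule order_tendstoI)
    fix y assume "y < h x"
    then show "\<forall>\<^sub>F k in sequentially. y < h (X k)"
      by (rule lsc_eventually_gt[OF lsc X])
  next
    fix y assume y: "h x < y"
    have "(\<lambda>k. ereal (\<alpha> + e k x)) \<longlonglongrightarrow> ereal (\<alpha> + 0)"
      using e[of x] by (intro tendsto_intros) simp
    then have "\<forall>\<^sub>F k in sequentially. ereal (\<alpha> + e k x) < y"
      using y \<alpha> by (intro order_tendstoD(2)) auto
    then show "\<forall>\<^sub>F k in sequentially. h (X k) < y"
      using le[of _ x] \<alpha> by (auto elim!: eventually_mono intro: le_less_trans)
  qed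
  show "- (transpose C *v \<eta>) \<in> limiting_subdiff h x"
    unfolding limiting_subdiff_def mem_Collect_eq
  proof (rule conjI[OF _ exI[of _ X, OF exI[of _ "\<lambda>k. - (transpose C *v E k)"]]], goal_cases)
    case 1
    show ?case using fin by (auto simp: edom_def)
  next
    case 2
    have "(\<lambda>k. - (transpose C *v E k)) \<longlonglongrightarrow> - (transpose C *v \<eta>)"
      by (intro tendsto_intros E bounded_linear.tendsto[OF matrix_vector_mul_bounded_linear])
    then show ?case
      using X conv quad_min_regular_subdiff[OF min \<open>\<beta> \<ge> 0\<close>] by simp
  qed
qed

lemma epicomp_le: "epicomp C h (C *v x) \<le> h x"
  unfolding epicomp_def by (rule INF_lower) simp

text \<open>The condition depends on \<open>x'\<close> only through \<open>C x'\<close>, so it passes to the epicomposition, and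
  \<open>x\<close> attains the infimum over its fibre.\<close>

lemma quad_min_epicomp:
  assumes "quad_min h C \<eta> \<beta> x"
  shows "epicomp C h (C *v x) = h x"
    and "h x \<le> epicomp C h s + ereal (\<eta> \<bullet> (s - C *v x) + \<beta> / 2 * (norm (s - C *v x))\<^sup>2)"
proof -
  obtain a where a: "h x = ereal a"
    using assms by (auto simp: quad_min_def)
  have *: "h x \<le> epicomp C h s + ereal (\<eta> \<bullet> (s - C *v x) + \<beta> / 2 * (norm (s - C *v x))\<^sup>2)" (is "_ \<le> _ + ereal ?q") for s
  proof -
    have "ereal (a - ?q) \<le> epicomp C h s"
      unfolding epicomp_def
    proof (rule INF_greatest)
      fix x' assume "x' \<in> {x. C *v x = s}"
      then have s: "s = C *v x'" by simp
      then have "ereal a \<le> h x' + ereal ?q"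
        using assms by (simp add: quad_min_def a)
      then show "ereal (a - ?q) \<le> h x'"
        by (cases "h x'") auto
    qed
    then show ?thesis
      by (cases "epicomp C h s") (auto simp: a)
  qed
  then show "h x \<le> epicomp C h s + ereal (\<eta> \<bullet> (s - C *v x) + \<beta> / 2 * (norm (s - C *v x))\<^sup>2)" .
  show "epicomp C h (C *v x) = h x"
    using *[of "C *v x"] epicomp_le[of C h x] by (intro antisym) auto
qed

section \<open>Functions with Lipschitz continuous gradient\<close>

text \<open>The remainder of the first-order expansion, restricted to a segment, has derivative at most
  \<open>L t |s - u|\<^sup>2\<close>.\<close>

lemma quadratic_upper_bound:
  fixes F :: "'a::real_inner \<Rightarrow> real"
  assumes grad: "\<And>x. GDERIV F x :> G x" and lip: "L-lipschitz_on UNIV G"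
  shows "F s \<le> F u + G u \<bullet> (s - u) + L / 2 * (norm (s - u))\<^sup>2"
proof -
  define d where "d = s - u"
  define \<phi> where "\<phi> t = F (u + t *\<^sub>R d) - t * (G u \<bullet> d) - L / 2 * (t\<^sup>2 * (norm d)\<^sup>2)" for t
  have "\<phi> 1 \<le> \<phi> 0"
  proof (rule DERIV_nonpos_imp_nonincreasing[where f = \<phi>])
    fix t :: real assume t: "0 \<le> t" "t \<le> 1"
    have "((\<lambda>t. F (u + t *\<^sub>R d)) has_real_derivative d \<bullet> G (u + t *\<^sub>R d)) (at t)"
    proof -
      have "((\<lambda>t. F (u + t *\<^sub>R d)) has_derivative (\<lambda>h. (h *\<^sub>R d) \<bullet> G (u + t *\<^sub>R d))) (at t)"
        by (rule has_derivative_compose[of "\<lambda>t. u + t *\<^sub>R d" "\<lambda>h. h *\<^sub>R d" t UNIV F])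
          (use grad in \<open>auto simp: gderiv_def intro!: derivative_eq_intros\<close>)
      then show ?thesis
        by (simp add: has_field_derivative_def mult_commute_abs)
    qed
    then have "(\<phi> has_real_derivative
        d \<bullet> G (u + t *\<^sub>R d) - G u \<bullet> d - L / 2 * (2 * t * (norm d)\<^sup>2)) (at t)"
      unfolding \<phi>_def by (auto intro!: derivative_eq_intros)
    moreover have "d \<bullet> G (u + t *\<^sub>R d) - G u \<bullet> d \<le> L * (t * (norm d)\<^sup>2)"
    proof -
      have "d \<bullet> G (u + t *\<^sub>R d) - G u \<bullet> d = d \<bullet> (G (u + t *\<^sub>R d) - G u)"
        by (simp add: inner_diff_right inner_commute)
      also have "\<dots> \<le> norm d * norm (G (u + t *\<^sub>R d) - G u)"
        by (rule norm_cauchy_schwarz)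
      also have "\<dots> \<le> norm d * (L * norm (t *\<^sub>R d))"
        using lipschitz_onD[OF lip, of "u + t *\<^sub>R d" u]
        by (intro mult_left_mono) (auto simp: dist_norm)
      finally show ?thesis
        using t by (simp add: power2_eq_square mult_ac)
    qed
    ultimately show "\<exists>y. DERIV \<phi> t :> y \<and> y \<le> 0"
      by (intro exI[of _ "d \<bullet> G (u + t *\<^sub>R d) - G u \<bullet> d - L / 2 * (2 * t * (norm d)\<^sup>2)"]) simp
  qed simp
  then show ?thesis
    by (simp add: \<phi>_def d_def)
qed

lemma quadratic_lower_bound:
  fixes F :: "'a::real_inner \<Rightarrow> real"
  assumes grad: "\<And>x. GDERIV F x :> G x" and lip: "L-lipschitz_on UNIV G"
  shows "F u + G u \<bullet> (s - u) - L / 2 * (norm (s - u))\<^sup>2 \<le> F s"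
  using quadratic_upper_bound[OF GDERIV_minus[OF grad] lipschitz_on_minus[OF lip], of s u]
  by simp

text \<open>The second bound is cocoercivity of the gradient: a gradient step from \<open>u\<close> lowers the gap
  by at least \<open>|G u' - G u|\<^sup>2 / (2 L)\<close>, and the gap is still nonnegative at the new point.\<close>

lemma convex_gradient_gap:
  fixes F :: "'a::real_inner \<Rightarrow> real"
  assumes grad: "\<And>x. GDERIV F x :> G x" and lip: "L-lipschitz_on UNIV G"
    and cvx: "econvex (\<lambda>x. ereal (F x))"
  defines "gap \<equiv> \<lambda>u u'. F u - F u' - G u' \<bullet> (u - u')"
  shows "0 \<le> gap u u'" "(norm (G u' - G u))\<^sup>2 \<le> 2 * L * gap u u'"
proof -
  have gap: "0 \<le> gap u u'" for u u'
  proof -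
    have "F u' + 0 / 2 * (norm (u - u'))\<^sup>2 \<le> F u + (- G u') \<bullet> (u - u')"
    proof (rule growth_of_perturbed_min[where h = "\<lambda>x. ereal (F x)" and K = "L / 2"])
      show "econvex (\<lambda>x. ereal (F x) - ereal (0 / 2 * (norm x)\<^sup>2))"
        using cvx by simp
      show "ereal (F u') \<le> ereal (F s) + ereal (- G u' \<bullet> (s - u') + L / 2 * (norm (s - u'))\<^sup>2)" for s
        using quadratic_lower_bound[OF grad lip, of u' s] by simp
    qed auto
    then show ?thesis by (simp add: gap_def)
  qed
  show "0 \<le> gap u u'" by (rule gap)
  have "L \<ge> 0" using lip by (rule lipschitz_on_nonneg)
  show "(norm (G u' - G u))\<^sup>2 \<le> 2 * L * gap u u'"
  proof (cases "L = 0")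
    case True
    then show ?thesis
      using lipschitz_onD[OF lip, of u' u] by (simp add: dist_norm)
  next
    case False
    then have L: "L > 0" using \<open>L \<ge> 0\<close> by simp
    define D where "D = G u' - G u"
    \<comment> \<open>a gradient step for \<open>F - G u' \<bullet> _\<close>, whose gradient at \<open>u\<close> is \<open>- D\<close>\<close>
    define s where "s = u + (1 / L) *\<^sub>R D"
    have up: "F s \<le> F u + G u \<bullet> (s - u) + L / 2 * (norm (s - u))\<^sup>2"
      by (rule quadratic_upper_bound[OF grad lip])
    have "0 \<le> gap s u'" by (rule gap)
    then have "0 \<le> F u + G u \<bullet> (s - u) + L / 2 * (norm (s - u))\<^sup>2 - F u' - G u' \<bullet> (s - u')"
      using up by (simp add: gap_def)
    also have "\<dots> = gap u u' - D \<bullet> (s - u) + L / 2 * (norm (s - u))\<^sup>2"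
      by (simp add: gap_def D_def algebra_simps inner_simps)
    also have "\<dots> = gap u u' - 1 / L * (norm D)\<^sup>2 + L / 2 * ((1 / L)\<^sup>2 * (norm D)\<^sup>2)"
      unfolding s_def using L by (simp add: power_mult_distrib power2_norm_eq_inner power_divide)
    also have "\<dots> = gap u u' - (norm D)\<^sup>2 / (2 * L)"
      using L by (simp add: field_simps power2_eq_square)
    finally show ?thesis
      using L by (simp add: D_def field_simps)
  qed
qed

text \<open>The first-order condition at a minimum, proved by a small step along \<open>- (G u + \<eta>)\<close>, against which
  both quadratic remainders are of second order.\<close>

lemma gradient_eq_of_perturbed_min:
  fixes F :: "'a::real_inner \<Rightarrow> real"
  assumes grad: "\<And>x. GDERIV F x :> G x" and lip: "L-lipschitz_on UNIV G"
    and min: "\<And>s. F u \<le> F s + \<eta> \<bullet> (s - u) + K * (norm (s - u))\<^sup>2"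
  shows "G u = - \<eta>"
proof -
  define N where "N = G u + \<eta>"
  have "(norm N)\<^sup>2 \<le> 0"
  proof (rule le_if_le_add_small)
    fix t :: real assume t: "0 < t" "t < 1"
    define s where "s = u - t *\<^sub>R N"
    have "0 \<le> N \<bullet> (s - u) + (L / 2 + K) * (norm (s - u))\<^sup>2"
      using min[of s] quadratic_upper_bound[OF grad lip, of s u]
      by (simp add: N_def inner_add_left distrib_right)
    also have "\<dots> = - (t * (norm N)\<^sup>2) + (L / 2 + K) * (t\<^sup>2 * (norm N)\<^sup>2)"
      by (simp add: s_def power_mult_distrib power2_norm_eq_inner[of N])
    also have "\<dots> = t * (- (norm N)\<^sup>2 + t * ((L / 2 + K) * (norm N)\<^sup>2))"
      by (simp add: algebra_simps power2_eq_square)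
    finally show "(norm N)\<^sup>2 \<le> 0 + t * ((L / 2 + K) * (norm N)\<^sup>2)"
      using t by (simp add: zero_le_mult_iff)
  qed
  then show ?thesis
    by (simp add: N_def add_eq_0_iff2)
qed

section \<open>Decrease of the Douglas-Rachford envelope\<close>

text \<open>Here \<open>P, P'\<close> and \<open>G, G'\<close> are values and gradients of one smooth function at \<open>u\<close> and \<open>u'\<close>. With
  \<open>\<Delta> = u' - u\<close> and \<open>D = G' - G\<close>, the relation \<open>step\<close> turns the difference of the two envelopes into
  \<open>gap + \<beta> (2 - \<lambda>)/(2 \<lambda>) |\<Delta>|\<^sup>2 - |D|\<^sup>2/(\<beta> \<lambda>)\<close>. The gap is bounded below by \<open>- L/2 |\<Delta>|\<^sup>2\<close>, or by
  \<open>|D|\<^sup>2/(2 L)\<close> under convexity, and \<open>|w - u|\<close> is at most \<open>(1 + L/\<beta>)/\<lambda> |\<Delta>|\<close>. Stating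
  it at two points lets the dual function of the strongly convex case enter through minimizers
  alone.\<close>

lemma douglas_rachford_decrease:
  fixes u u' w G G' :: "'a::real_inner" and P P' L \<beta> lam :: real and cvx :: bool
  assumes "\<beta> > 0" "L \<ge> 0" and lam: "0 < lam" "lam < 2"
    and step: "\<beta> *\<^sub>R (u' - u) + (G' - G) = (\<beta> * lam) *\<^sub>R (w - u)"
    and lip: "norm (G' - G) \<le> L * norm (u' - u)"
    and gap: "- (L / 2) * (norm (u' - u))\<^sup>2 \<le> P - P' - G' \<bullet> (u - u')"
    and gap_cvx: "cvx \<Longrightarrow> 0 \<le> P - P' - G' \<bullet> (u - u')"
      "cvx \<Longrightarrow> (norm (G' - G))\<^sup>2 \<le> 2 * L * (P - P' - G' \<bullet> (u - u'))"
    and c: "0 < c" "c \<le> lam / (1 + L / \<beta>)\<^sup>2 *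
      ((2 - lam) / 2 - L / \<beta> * (if cvx then max (L / \<beta> - lam / 2) 0 else 1))"
  shows "P' + G' \<bullet> (w - u') + \<beta> / 2 * (norm (w - u'))\<^sup>2
    \<le> P + G \<bullet> (w - u) + \<beta> / 2 * (norm (w - u))\<^sup>2 - \<beta> * c * (norm (w - u))\<^sup>2"
proof -
  define \<Delta> D \<rho> where "\<Delta> = u' - u" and "D = G' - G" and "\<rho> = w - u"
  define \<gamma> where "\<gamma> = P - P' - G' \<bullet> (u - u')"
  define m where "m = (if cvx then max (L / \<beta> - lam / 2) 0 else 1)"
  define \<kappa> where "\<kappa> = (2 - lam) / 2 - L / \<beta> * m"
  have \<rho>: "\<rho> = (1 / (\<beta> * lam)) *\<^sub>R (\<beta> *\<^sub>R \<Delta> + D)"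
    using step \<open>\<beta> > 0\<close> lam by (simp add: \<Delta>_def D_def \<rho>_def)
  have "0 < lam / (1 + L / \<beta>)\<^sup>2 * \<kappa>"
    using c unfolding \<kappa>_def m_def by linarith
  moreover have pos: "1 + L / \<beta> > 0"
    using \<open>\<beta> > 0\<close> \<open>L \<ge> 0\<close> by (simp add: add_pos_nonneg)
  ultimately have \<kappa>: "\<kappa> > 0"
    using lam by (simp add: zero_less_mult_iff zero_less_divide_iff)
  have D: "(norm D)\<^sup>2 \<le> L\<^sup>2 * (norm \<Delta>)\<^sup>2"
    using power_mono[OF lip, of 2] by (simp add: D_def \<Delta>_def power_mult_distrib)
  have lower: "- (L / lam * m) * (norm \<Delta>)\<^sup>2 \<le> \<gamma> - (norm D)\<^sup>2 / (\<beta> * lam)"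
  proof (cases cvx)
    case False
    have "L / \<beta> \<le> (2 - lam) / 2"
      using \<kappa> False by (simp add: \<kappa>_def m_def)
    then have "L / lam * (L / \<beta>) \<le> L / lam * ((2 - lam) / 2)"
      using \<open>L \<ge> 0\<close> lam by (intro mult_left_mono) auto
    moreover have "L\<^sup>2 / (\<beta> * lam) = L / lam * (L / \<beta>)"
      by (simp add: power2_eq_square)
    moreover have "L / lam * ((2 - lam) / 2) = L / lam - L / 2"
      using lam by (simp add: field_simps)
    ultimately have "L\<^sup>2 / (\<beta> * lam) + L / 2 \<le> L / lam"
      by linarith
    then have "(L\<^sup>2 / (\<beta> * lam) + L / 2) * (norm \<Delta>)\<^sup>2 \<le> L / lam * (norm \<Delta>)\<^sup>2"
      by (intro mult_right_mono) auto
    moreover have "(norm D)\<^sup>2 / (\<beta> * lam) \<le> L\<^sup>2 / (\<beta> * lam) * (norm \<Delta>)\<^sup>2"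
      using D \<open>\<beta> > 0\<close> lam by (simp add: divide_right_mono)
    ultimately show ?thesis
      using gap False by (simp add: m_def \<gamma>_def \<Delta>_def algebra_simps)
  next
    case True
    then have \<gamma>: "0 \<le> \<gamma>" "(norm D)\<^sup>2 \<le> 2 * L * \<gamma>"
      using gap_cvx by (auto simp: \<gamma>_def D_def)
    show ?thesis
    proof (cases "L / \<beta> \<le> lam / 2")
      case True
      then have "2 * L \<le> \<beta> * lam"
        using \<open>\<beta> > 0\<close> by (simp add: field_simps)
      then have "2 * L * \<gamma> \<le> \<beta> * lam * \<gamma>"
        using \<gamma> by (intro mult_right_mono) auto
      then have "(norm D)\<^sup>2 / (\<beta> * lam) \<le> \<gamma>"
        using \<gamma> \<open>\<beta> > 0\<close> lam by (simp add: pos_divide_le_eq mult_ac)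
      then show ?thesis
        using \<open>cvx\<close> True by (simp add: m_def max_def)
    next
      case False
      then have L: "L > 0"
        using \<open>L \<ge> 0\<close> lam by (cases "L = 0") auto
      have m: "m = L / \<beta> - lam / 2"
        using \<open>cvx\<close> False by (simp add: m_def)
      define k where "k = 1 / (\<beta> * lam) - 1 / (2 * L)"
      have k: "k \<ge> 0"
        using False L \<open>\<beta> > 0\<close> lam by (simp add: k_def field_simps)
      have "(norm D)\<^sup>2 / (2 * L) \<le> \<gamma>"
        using \<gamma> L by (simp add: field_simps)
      then have "(norm D)\<^sup>2 / (\<beta> * lam) - \<gamma> \<le> k * (norm D)\<^sup>2"
        by (simp add: k_def left_diff_distrib)
      also have "\<dots> \<le> k * (L\<^sup>2 * (norm \<Delta>)\<^sup>2)"
        using D k by (rule mult_left_mono)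
      also have "k * L\<^sup>2 = L / lam * m"
        unfolding m k_def using L \<open>\<beta> > 0\<close> lam by (simp add: field_simps power2_eq_square)
      then have "k * (L\<^sup>2 * (norm \<Delta>)\<^sup>2) = L / lam * m * (norm \<Delta>)\<^sup>2"
        by (simp flip: mult.assoc)
      finally show ?thesis by simp
    qed
  qed
  have "norm \<rho> \<le> (1 + L / \<beta>) / lam * norm \<Delta>"
  proof -
    have "norm \<rho> = 1 / (\<beta> * lam) * norm (\<beta> *\<^sub>R \<Delta> + D)"
      using \<open>\<beta> > 0\<close> lam by (simp add: \<rho>)
    also have "norm (\<beta> *\<^sub>R \<Delta> + D) \<le> \<beta> * norm \<Delta> + L * norm \<Delta>"
      using norm_triangle_ineq[of "\<beta> *\<^sub>R \<Delta>" D] lip \<open>\<beta> > 0\<close> by (simp add: \<Delta>_def D_def)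
    finally show ?thesis
      using \<open>\<beta> > 0\<close> lam by (simp add: field_simps)
  qed
  then have \<rho>2: "(norm \<rho>)\<^sup>2 \<le> ((1 + L / \<beta>) / lam)\<^sup>2 * (norm \<Delta>)\<^sup>2"
    unfolding power_mult_distrib[symmetric] by (intro power_mono) auto
  have "\<beta> * c * (norm \<rho>)\<^sup>2 \<le> \<beta> * (lam / (1 + L / \<beta>)\<^sup>2 * \<kappa>) * (norm \<rho>)\<^sup>2"
    using c \<open>\<beta> > 0\<close> unfolding \<kappa>_def m_def by (intro mult_right_mono mult_left_mono) auto
  also have "\<dots> \<le> \<beta> * (lam / (1 + L / \<beta>)\<^sup>2 * \<kappa>) * (((1 + L / \<beta>) / lam)\<^sup>2 * (norm \<Delta>)\<^sup>2)"
    using \<rho>2 \<kappa> lam \<open>\<beta> > 0\<close> by (intro mult_left_mono) auto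
  also have "\<dots> = \<beta> / lam * \<kappa> * (norm \<Delta>)\<^sup>2"
  proof -
    have "\<beta> * (lam / q\<^sup>2 * \<kappa>) * ((q / lam)\<^sup>2 * n) = \<beta> / lam * \<kappa> * n" if "q > 0" for q n :: real
      using that lam by (simp add: field_simps power2_eq_square)
    from this[OF pos] show ?thesis .
  qed
  also have "\<dots> = \<beta> / lam * ((2 - lam) / 2) * (norm \<Delta>)\<^sup>2 - L / lam * m * (norm \<Delta>)\<^sup>2"
    using \<open>\<beta> > 0\<close> lam by (simp add: \<kappa>_def field_simps)
  also have "\<dots> \<le> \<beta> / lam * ((2 - lam) / 2) * (norm \<Delta>)\<^sup>2 + \<gamma> - (norm D)\<^sup>2 / (\<beta> * lam)"
    using lower by simp
  also have "\<dots> = \<gamma> + (\<beta> *\<^sub>R \<Delta> - D) \<bullet> \<rho> - \<beta> / 2 * (norm \<Delta>)\<^sup>2"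
  proof -
    have "(\<beta> *\<^sub>R \<Delta> - D) \<bullet> \<rho> = (\<beta>\<^sup>2 * (norm \<Delta>)\<^sup>2 - (norm D)\<^sup>2) / (\<beta> * lam)"
      unfolding \<rho> power2_norm_eq_inner
      by (simp add: inner_simps inner_commute power2_eq_square)
    show ?thesis
      unfolding \<open>(\<beta> *\<^sub>R \<Delta> - D) \<bullet> \<rho> = _\<close>
      using \<open>\<beta> > 0\<close> lam by (simp add: field_simps power2_eq_square)
  qed
  also have "\<dots> = (P + G \<bullet> (w - u) + \<beta> / 2 * (norm (w - u))\<^sup>2)
      - (P' + G' \<bullet> (w - u') + \<beta> / 2 * (norm (w - u'))\<^sup>2)"
    unfolding \<gamma>_def \<Delta>_def D_def \<rho>_def power2_norm_eq_inner
    by (simp add: inner_simps inner_commute algebra_simps)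
  finally show ?thesis
    by (simp add: \<rho>_def)
qed

section \<open>ADMM triplets and linesearch runs\<close>

lemma argmin_quad_min:
  fixes h :: "real^'q \<Rightarrow> ereal" and C :: "real^'q^'p"
  assumes min: "x \<in> argmin (\<lambda>x'. ereal k + h x' + ereal (\<eta> \<bullet> (C *v x' + e) + \<beta> / 2 * (norm (C *v x' + e))\<^sup>2))"
    and bot: "\<And>x. h x \<noteq> -\<infinity>"
  shows "quad_min h C (\<eta> + \<beta> *\<^sub>R (C *v x + e)) \<beta> x"
proof -
  define q where "q x' = \<eta> \<bullet> (C *v x' + e) + \<beta> / 2 * (norm (C *v x' + e))\<^sup>2" for x'
  have fin: "h x \<noteq> \<infinity>"
    using min by (auto simp: argmin_def)
  then obtain a where a: "h x = ereal a"
    using bot[of x] by (cases "h x") auto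
  have "h x \<le> h x' + ereal (q x' - q x)" for x'
  proof -
    have "ereal k + h x + ereal (q x) \<le> ereal k + h x' + ereal (q x')"
      using min unfolding argmin_def q_def by blast
    then show ?thesis
      using bot[of x'] by (cases "h x'") (auto simp: a)
  qed
  moreover have "q x' - q x = (\<eta> + \<beta> *\<^sub>R (C *v x + e)) \<bullet> (C *v x' - C *v x)
      + \<beta> / 2 * (norm (C *v x' - C *v x))\<^sup>2" for x'
    unfolding q_def power2_norm_eq_inner
    by (simp add: inner_simps inner_commute algebra_simps)
  ultimately show ?thesis
    by (simp add: quad_min_def a)
qed

text \<open>The multiplier of the \<open>x\<close>-step is the new \<open>y\<close>, by the very definition of the \<open>y\<close>-update; the
  \<open>z\<close>-step comes after that update, hence the extra \<open>\<beta> r\<close>.\<close>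

lemma admmD:
  assumes "(x, y, z) \<in> admm f g A B b \<beta> yt zt"
    and f: "\<And>x. f x \<noteq> -\<infinity>" and g: "\<And>z. g z \<noteq> -\<infinity>"
  shows "quad_min f A y \<beta> x" "quad_min g B (y + \<beta> *\<^sub>R resid A B b x z) \<beta> z"
    "y = yt + \<beta> *\<^sub>R (A *v x + B *v zt - b)"
proof -
  show y: "y = yt + \<beta> *\<^sub>R (A *v x + B *v zt - b)"
    using assms by (simp add: admm_def)
  have "x \<in> argmin (\<lambda>x'. ereal 0 + f x'
      + ereal (yt \<bullet> (A *v x' + (B *v zt - b)) + \<beta> / 2 * (norm (A *v x' + (B *v zt - b)))\<^sup>2))"
    using assms(1) by (simp add: admm_def aug_lag_def resid_def add_diff_eq flip: zero_ereal_def)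
  from argmin_quad_min[OF this f] show x: "quad_min f A y \<beta> x"
    by (simp add: y add_diff_eq)
  then obtain a where a: "f x = ereal a"
    by (auto simp: quad_min_def)
  have eq: "A *v x + B *v z' - b = B *v z' + (A *v x - b)" for z'
    by simp
  have "z \<in> argmin (\<lambda>z'. ereal a + g z'
      + ereal (y \<bullet> (B *v z' + (A *v x - b)) + \<beta> / 2 * (norm (B *v z' + (A *v x - b)))\<^sup>2))"
    using assms(1) unfolding admm_def mem_Collect_eq split aug_lag_def resid_def a eq by blast
  from argmin_quad_min[OF this g] show "quad_min g B (y + \<beta> *\<^sub>R resid A B b x z) \<beta> z"
    by (simp add: resid_def add_ac add_diff_eq)
qed

lemma ls_admm_run_admm:
  assumes run: "ls_admm_run f g A B b \<pi> lam \<beta> c imax \<epsilon> xm ym zm x y z"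
  shows "\<exists>yt zt. (x k, y k, z k) \<in> admm f g A B b \<beta> yt zt"
proof (induction k)
  case 0
  then show ?case using run by (auto simp: ls_admm_run_def)
next
  case (Suc k)
  show ?case
  proof (cases "\<beta> * norm (resid A B b (x k) (z k)) \<le> \<epsilon>")
    case True
    then show ?thesis using run Suc by (auto simp: ls_admm_run_def)
  next
    case False
    then have "ls_step f g A B b \<pi> lam \<beta> c imax (x k, y k, z k) (x (Suc k), y (Suc k), z (Suc k))"
      using run by (auto simp: ls_admm_run_def)
    then show ?thesis
      unfolding ls_step_def Let_def split by (metis order_refl)
  qed
qed

text \<open>Exhausting the backtracks leads to the nominal step, which is assumed to pass the test; a run
  that has stopped has zero residual and passes it trivially.\<close>

lemma ls_admm_run_accept:
  assumes run: "ls_admm_run f g A B b \<pi> lam \<beta> c imax 0 xm ym zm x y z" and "\<beta> > 0"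
    and nominal: "\<And>yt zt x y z w. (x, y, z) \<in> admm f g A B b \<beta> yt zt \<Longrightarrow>
      w \<in> admm f g A B b \<beta> (y - (\<beta> * (1 - lam)) *\<^sub>R resid A B b x z) z \<Longrightarrow>
      ls_accept f g A B b \<pi> \<beta> c (x, y, z) w"
  shows "ls_accept f g A B b \<pi> \<beta> c (x k, y k, z k) (x (Suc k), y (Suc k), z (Suc k))"
proof (cases "\<beta> * norm (resid A B b (x k) (z k)) \<le> 0")
  case True
  then have "resid A B b (x k) (z k) = 0"
    using \<open>\<beta> > 0\<close> by (simp add: mult_le_0_iff)
  then show ?thesis
    using True run by (auto simp: ls_admm_run_def ls_accept_def)
next
  case False
  then have step: "ls_step f g A B b \<pi> lam \<beta> c imax (x k, y k, z k) (x (Suc k), y (Suc k), z (Suc k))"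
    using run by (auto simp: ls_admm_run_def)
  obtain yt zt where "(x k, y k, z k) \<in> admm f g A B b \<beta> yt zt"
    using ls_admm_run_admm[OF run] by blast
  from nominal[OF this] step show ?thesis
    unfolding ls_step_def Let_def split by metis
qed

lemma admm_z_min:
  assumes "(x, y, z) \<in> admm f g A B b \<beta> yt zt"
  shows "aug_lag f g A B b \<beta> x z y \<le> aug_lag f g A B b \<beta> x z' y"
  using assms unfolding admm_def argmin_def by blast

lemma boundedI_seq:
  fixes X :: "nat \<Rightarrow> 'a::real_normed_vector"
  assumes "\<And>k. norm (X k) \<le> K"
  shows "bounded (range X)"
  using assms by (auto simp: bounded_iff)

lemma bounded_seq_Pair:
  fixes X :: "nat \<Rightarrow> 'a::real_normed_vector" and Y :: "nat \<Rightarrow> 'b::real_normed_vector"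
  assumes "bounded (range X)" "bounded (range Y)"
  shows "bounded (range (\<lambda>k. (X k, Y k)))"
  by (rule bounded_subset[OF bounded_Times[OF assms]]) auto

text \<open>What the two cases share: ADMM triplets along which \<open>\<pi>\<close> times the augmented Lagrangian
  decreases by \<open>\<beta> c |r|\<^sup>2\<close>.\<close>

locale admm_descent =
  fixes f :: "real^'m \<Rightarrow> ereal" and g :: "real^'n \<Rightarrow> ereal"
    and A :: "real^'m^'p" and B :: "real^'n^'p" and b :: "real^'p"
    and \<pi> \<beta> c :: real
    and x :: "nat \<Rightarrow> real^'m" and y :: "nat \<Rightarrow> real^'p" and z :: "nat \<Rightarrow> real^'n"
  assumes f_bot: "\<And>s. f s \<noteq> -\<infinity>" and g_bot: "\<And>s. g s \<noteq> -\<infinity>"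
    and \<beta>_pos: "\<beta> > 0" and c_pos: "c > 0" and \<pi>: "\<pi> = 1 \<or> \<pi> = -1"
    and admm: "\<And>k. \<exists>yt zt. (x k, y k, z k) \<in> admm f g A B b \<beta> yt zt"
    and accept: "\<And>k. ls_accept f g A B b \<pi> \<beta> c (x k, y k, z k) (x (Suc k), y (Suc k), z (Suc k))"
begin

definition r :: "nat \<Rightarrow> real^'p" where "r k = resid A B b (x k) (z k)"
definition fx :: "nat \<Rightarrow> real" where "fx k = real_of_ereal (f (x k))"
definition gz :: "nat \<Rightarrow> real" where "gz k = real_of_ereal (g (z k))"
definition lag :: "nat \<Rightarrow> real" where
  "lag k = fx k + gz k + (y k \<bullet> r k + \<beta> / 2 * (norm (r k))\<^sup>2)"

lemma quad_min_x: "quad_min f A (y k) \<beta> (x k)"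
  and quad_min_z: "quad_min g B (y k + \<beta> *\<^sub>R r k) \<beta> (z k)"
proof -
  obtain yt zt where "(x k, y k, z k) \<in> admm f g A B b \<beta> yt zt"
    using admm by blast
  from admmD(1,2)[OF this f_bot g_bot]
  show "quad_min f A (y k) \<beta> (x k)" "quad_min g B (y k + \<beta> *\<^sub>R r k) \<beta> (z k)"
    by (simp_all add: r_def)
qed

lemma f_x: "f (x k) = ereal (fx k)"
  using quad_min_x[of k] by (auto simp: quad_min_def fx_def)

lemma g_z: "g (z k) = ereal (gz k)"
  using quad_min_z[of k] by (auto simp: quad_min_def gz_def)

lemma aug_lag_eq: "aug_lag f g A B b \<beta> (x k) (z k) (y k) = ereal (lag k)"
  by (simp add: aug_lag_def f_x g_z lag_def r_def)

lemma lag_step: "\<beta> * c * (norm (r k))\<^sup>2 \<le> \<pi> * lag k - \<pi> * lag (Suc k)"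
  using accept[of k] by (simp add: ls_accept_def aug_lag_eq r_def)

lemma lag_mono: "j \<le> k \<Longrightarrow> \<pi> * lag k \<le> \<pi> * lag j"
proof (induction rule: dec_induct)
  case (step k)
  have "0 \<le> \<beta> * c * (norm (r k))\<^sup>2"
    using \<beta>_pos c_pos by simp
  then show ?case
    using lag_step[of k] step by simp
qed simp

lemma summable_resid:
  assumes "\<And>k. M \<le> \<pi> * lag k"
  shows "summable (\<lambda>k. (norm (r k))\<^sup>2)"
proof (rule summableI_nonneg_bounded)
  fix n
  have "\<beta> * c * (\<Sum>k<n. (norm (r k))\<^sup>2) \<le> \<pi> * lag 0 - \<pi> * lag n"
  proof (induction n)
    case (Suc n)
    then show ?case
      using lag_step[of n] by (simp add: distrib_left)
  qed simp
  also have "\<dots> \<le> \<pi> * lag 0 - M"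
    using assms by simp
  finally show "(\<Sum>k<n. (norm (r k))\<^sup>2) \<le> (\<pi> * lag 0 - M) / (\<beta> * c)"
    using \<beta>_pos c_pos by (simp add: pos_le_divide_eq mult.commute)
qed simp

lemma r_tendsto_0:
  assumes "\<And>k. M \<le> \<pi> * lag k"
  shows "r \<longlonglongrightarrow> 0"
proof -
  have "(\<lambda>k. (norm (r k))\<^sup>2) \<longlonglongrightarrow> 0"
    using summable_resid[OF assms] by (rule summable_LIMSEQ_zero)
  then have "(\<lambda>k. sqrt ((norm (r k))\<^sup>2)) \<longlonglongrightarrow> sqrt 0"
    by (rule tendsto_real_sqrt)
  then show ?thesis
    by (simp add: tendsto_norm_zero_iff)
qed

lemma lag_convergent:
  assumes "\<And>k. M \<le> \<pi> * lag k"
  shows "convergent lag"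
proof -
  have "decseq (\<lambda>k. \<pi> * lag k)"
    by (simp add: decseq_def lag_mono)
  then obtain l where "(\<lambda>k. \<pi> * lag k) \<longlonglongrightarrow> l"
    using decseq_convergent[of "\<lambda>k. \<pi> * lag k" M] assms by blast
  then have "(\<lambda>k. \<pi> * (\<pi> * lag k)) \<longlonglongrightarrow> \<pi> * l"
    by (intro tendsto_intros)
  moreover have "\<pi> * (\<pi> * t) = t" for t
    using \<pi> by auto
  ultimately show ?thesis
    by (simp add: convergentI)
qed

lemma cluster_point_kkt:
  assumes lsc: "lsc f" "lsc g" and r0: "r \<longlonglongrightarrow> 0"
    and cluster: "cluster_point (\<lambda>k. (x k, y k, z k)) (xc, yc, zc)"
  shows "kkt f g A B b xc yc zc"
    and "\<exists>\<phi>. strict_mono \<phi> \<and> (\<lambda>k. ereal (lag (\<phi> k))) \<longlonglongrightarrow> f xc + g zc"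
proof -
  obtain \<phi> :: "nat \<Rightarrow> nat" where \<phi>: "strict_mono \<phi>"
    and lim: "(\<lambda>k. (x (\<phi> k), y (\<phi> k), z (\<phi> k))) \<longlonglongrightarrow> (xc, yc, zc)"
    using cluster by (auto simp: cluster_point_def o_def)
  have X: "(\<lambda>k. x (\<phi> k)) \<longlonglongrightarrow> xc" and Y: "(\<lambda>k. y (\<phi> k)) \<longlonglongrightarrow> yc" and Z: "(\<lambda>k. z (\<phi> k)) \<longlonglongrightarrow> zc"
    using tendsto_fst[OF lim] tendsto_fst[OF tendsto_snd[OF lim]]
      tendsto_snd[OF tendsto_snd[OF lim]] by simp_all
  have R: "(\<lambda>k. r (\<phi> k)) \<longlonglongrightarrow> 0"
    using LIMSEQ_subseq_LIMSEQ[OF r0 \<phi>] by (simp add: o_def)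
  have "(\<lambda>k. y (\<phi> k) + \<beta> *\<^sub>R r (\<phi> k)) \<longlonglongrightarrow> yc + \<beta> *\<^sub>R 0"
    by (intro tendsto_intros Y R)
  then have W: "(\<lambda>k. y (\<phi> k) + \<beta> *\<^sub>R r (\<phi> k)) \<longlonglongrightarrow> yc"
    by simp
  have \<beta>: "\<beta> \<ge> 0" using \<beta>_pos by simp
  note fl = quad_min_limit[OF lsc(1) f_bot X Y quad_min_x \<beta>]
  note gl = quad_min_limit[OF lsc(2) g_bot Z W quad_min_z \<beta>]
  have "(\<lambda>k. r (\<phi> k)) \<longlonglongrightarrow> A *v xc + B *v zc - b"
    unfolding r_def resid_def
    by (intro tendsto_intros bounded_linear.tendsto[OF matrix_vector_mul_bounded_linear] X Z)
  then have "A *v xc + B *v zc - b = 0"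
    using R LIMSEQ_unique by blast
  then show "kkt f g A B b xc yc zc"
    using fl(3) gl(3) by (simp add: kkt_def)
  obtain p q where pq: "f xc = ereal p" "g zc = ereal q"
    using fl(2) gl(2) by auto
  have "(\<lambda>k. fx (\<phi> k)) \<longlonglongrightarrow> p" "(\<lambda>k. gz (\<phi> k)) \<longlonglongrightarrow> q"
    using fl(1) gl(1) by (simp_all add: f_x g_z pq)
  then have "(\<lambda>k. lag (\<phi> k)) \<longlonglongrightarrow> p + q + (yc \<bullet> 0 + \<beta> / 2 * (norm (0 :: real^'p))\<^sup>2)"
    unfolding lag_def by (intro tendsto_intros Y R)
  then have "(\<lambda>k. ereal (lag (\<phi> k))) \<longlonglongrightarrow> f xc + g zc"
    by (simp add: pq)
  then show "\<exists>\<phi>. strict_mono \<phi> \<and> (\<lambda>k. ereal (lag (\<phi> k))) \<longlonglongrightarrow> f xc + g zc"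
    using \<phi> by blast
qed

end

section \<open>The smooth case\<close>

context
  fixes f :: "real^'m \<Rightarrow> ereal" and g :: "real^'n \<Rightarrow> ereal"
    and A :: "real^'m^'p" and B :: "real^'n^'p" and b :: "real^'p"
    and L lam \<beta> c :: real and F :: "real^'p \<Rightarrow> real" and G :: "real^'p \<Rightarrow> real^'p"
  assumes smooth: "smooth_case f g A B b L" and params: "smooth_params f A L lam \<beta> c"
    and F: "\<And>s. epicomp A f s = ereal (F s)"
    and grad: "\<And>s. GDERIV F s :> G s" and lip: "L-lipschitz_on UNIV G"
begin

lemma smooth_beta: "L \<ge> 0" "\<beta> > 0" "L \<le> \<beta>"
proof -
  show L: "L \<ge> 0" using lip by (rule lipschitz_on_nonneg)
  have lam: "0 < lam" "lam < 2"
    using params by (auto simp: smooth_params_def)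
  have "L * (2 - lam) \<le> L * 2"
    using L lam by (intro mult_left_mono) auto
  then have "L \<le> 2 * L / (2 - lam)"
    using lam by (simp add: pos_le_divide_eq mult.commute)
  then show "\<beta> > 0" "L \<le> \<beta>"
    using params L by (auto simp: smooth_params_def split: if_splits)
qed

lemma smooth_bot: "f s \<noteq> -\<infinity>" "g s' \<noteq> -\<infinity>"
proof -
  have "\<bar>f s\<bar> \<noteq> \<infinity>" "g s' \<noteq> -\<infinity>"
    using smooth unfolding smooth_case_def by simp_all
  then show "f s \<noteq> -\<infinity>" "g s' \<noteq> -\<infinity>"
    by auto
qed

lemma smooth_quad_min:
  assumes "quad_min f A y \<beta> x"
  shows "f x = ereal (F (A *v x))" "G (A *v x) = - y"
proof -
  show fx: "f x = ereal (F (A *v x))"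
    using quad_min_epicomp(1)[OF assms] F by simp
  show "G (A *v x) = - y"
  proof (rule gradient_eq_of_perturbed_min[OF grad lip])
    show "F (A *v x) \<le> F s + y \<bullet> (s - A *v x) + \<beta> / 2 * (norm (s - A *v x))\<^sup>2" for s
      using quad_min_epicomp(2)[OF assms, of s] by (simp add: fx F)
  qed
qed

text \<open>An instance of \<open>douglas_rachford_decrease\<close> with \<open>u = A x\<close>, \<open>w = b - B z\<close> and gradient \<open>- y\<close>. The
  \<open>z\<close>-step minimizes the new Lagrangian over \<open>w\<close>, so it may be compared with the old \<open>z\<close>.\<close>

lemma smooth_nominal:
  assumes w: "(x, y, z) \<in> admm f g A B b \<beta> yt zt"
    and w': "w' \<in> admm f g A B b \<beta> (y - (\<beta> * (1 - lam)) *\<^sub>R resid A B b x z) z"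
  shows "ls_accept f g A B b 1 \<beta> c (x, y, z) w'"
proof -
  obtain x' y' z' where w'_eq: "w' = (x', y', z')"
    by (cases w')
  define r where "r = resid A B b x z"
  note d = admmD[OF w smooth_bot] and d' = admmD[OF w'[unfolded w'_eq] smooth_bot]
  note s = smooth_quad_min[OF d(1)] and s' = smooth_quad_min[OF d'(1)]
  have y': "y' = y - (\<beta> * (1 - lam)) *\<^sub>R r + \<beta> *\<^sub>R (A *v x' + B *v z - b)"
    using d'(3) by (simp add: r_def)
  have "F (A *v x') + (- y') \<bullet> ((b - B *v z) - A *v x') + \<beta> / 2 * (norm ((b - B *v z) - A *v x'))\<^sup>2
    \<le> F (A *v x) + (- y) \<bullet> ((b - B *v z) - A *v x) + \<beta> / 2 * (norm ((b - B *v z) - A *v x))\<^sup>2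
      - \<beta> * c * (norm ((b - B *v z) - A *v x))\<^sup>2"
  proof (rule douglas_rachford_decrease[where lam = lam and L = L and cvx = "econvex (epicomp A f)"])
    show "\<beta> *\<^sub>R (A *v x' - A *v x) + (- y' - - y) = (\<beta> * lam) *\<^sub>R (b - B *v z - A *v x)"
      unfolding y' r_def resid_def by (simp add: algebra_simps)
    show "norm (- y' - - y) \<le> L * norm (A *v x' - A *v x)"
      using lipschitz_onD[OF lip, of "A *v x'" "A *v x"] by (simp add: s s' dist_norm)
    show "- (L / 2) * (norm (A *v x' - A *v x))\<^sup>2
        \<le> F (A *v x) - F (A *v x') - (- y') \<bullet> (A *v x - A *v x')"
      using quadratic_lower_bound[OF grad lip, of "A *v x'" "A *v x"] by (simp add: s' norm_minus_commute)
  next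
    assume cvx: "econvex (epicomp A f)"
    have "epicomp A f = (\<lambda>s. ereal (F s))"
      by (rule ext) (rule F)
    then have "econvex (\<lambda>s. ereal (F s))"
      using cvx by simp
    note cg = convex_gradient_gap[OF grad lip this, where u = "A *v x" and u' = "A *v x'"]
    show "0 \<le> F (A *v x) - F (A *v x') - (- y') \<bullet> (A *v x - A *v x')"
      using cg(1) by (simp add: s')
    show "(norm (- y' - - y))\<^sup>2 \<le> 2 * L * (F (A *v x) - F (A *v x') - (- y') \<bullet> (A *v x - A *v x'))"
      using cg(2) by (simp add: s s')
  next
    show "0 < lam" "lam < 2" "0 < c"
      using params unfolding smooth_params_def by blast+
    show "c \<le> lam / (1 + L / \<beta>)\<^sup>2 * ((2 - lam) / 2 -
        L / \<beta> * (if econvex (epicomp A f) then max (L / \<beta> - lam / 2) 0 else 1))"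
      using params unfolding smooth_params_def admm_const_def by (blast intro: less_imp_le)
  qed (use smooth_beta in auto)
  moreover have "(b - B *v z) - A *v s = - (A *v s + B *v z - b)" for s
    by simp
  ultimately have dec: "F (A *v x') + y' \<bullet> (A *v x' + B *v z - b) + \<beta> / 2 * (norm (A *v x' + B *v z - b))\<^sup>2
    \<le> F (A *v x) + y \<bullet> r + \<beta> / 2 * (norm r)\<^sup>2 - \<beta> * c * (norm r)\<^sup>2"
    by (simp only: norm_minus_cancel inner_minus_left inner_minus_right minus_minus r_def resid_def)
  obtain q where q: "g z = ereal q"
    using d(2) by (auto simp: quad_min_def)
  have "aug_lag f g A B b \<beta> x' z' y' \<le> aug_lag f g A B b \<beta> x' z y'"
    using w' unfolding w'_eq by (rule admm_z_min)
  also have "\<dots> = ereal (q + (F (A *v x') + y' \<bullet> (A *v x' + B *v z - b)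
      + \<beta> / 2 * (norm (A *v x' + B *v z - b))\<^sup>2))"
    by (simp add: aug_lag_def resid_def s' q)
  also have "\<dots> \<le> ereal (q + (F (A *v x) + y \<bullet> r + \<beta> / 2 * (norm r)\<^sup>2 - \<beta> * c * (norm r)\<^sup>2))"
    using dec by simp
  also have "\<dots> = aug_lag f g A B b \<beta> x z y - ereal (\<beta> * c * (norm r)\<^sup>2)"
    by (simp add: aug_lag_def s q r_def)
  finally show ?thesis
    by (simp add: ls_accept_def w'_eq r_def flip: one_ereal_def)
qed

end

locale smooth_admm_descent = admm_descent f g A B b 1 \<beta> c x y z
  for f :: "real^'m \<Rightarrow> ereal" and g :: "real^'n \<Rightarrow> ereal"
    and A :: "real^'m^'p" and B :: "real^'n^'p" and b :: "real^'p" and \<beta> c :: real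
    and x :: "nat \<Rightarrow> real^'m" and y :: "nat \<Rightarrow> real^'p" and z :: "nat \<Rightarrow> real^'n" +
  fixes L lam :: real and F :: "real^'p \<Rightarrow> real" and G :: "real^'p \<Rightarrow> real^'p"
  assumes smooth: "smooth_case f g A B b L" and params: "smooth_params f A L lam \<beta> c"
    and F: "\<And>s. epicomp A f s = ereal (F s)"
    and grad: "\<And>s. GDERIV F s :> G s" and lip: "L-lipschitz_on UNIV G"
begin

lemma fx_eq: "fx k = F (A *v x k)"
  and gradient_eq: "G (A *v x k) = - y k"
  using smooth_quad_min[OF smooth params F grad lip quad_min_x[of k]] by (simp_all add: f_x)

text \<open>The point \<open>b - B z\<close> is \<open>A x - r\<close>, so the value of \<open>(Af)\<close> there exceeds its linearization, which
  is the linear part of the Lagrangian, by at most \<open>L/2 |r|\<^sup>2\<close>. The penalty pays for this because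
  \<open>L \<le> \<beta>\<close>.\<close>

lemma value_le_lag: "F (b - B *v z k) + gz k \<le> lag k"
proof -
  have eq: "b - B *v z k - A *v x k = - r k"
    by (simp add: r_def resid_def)
  have "F (b - B *v z k) \<le> fx k + y k \<bullet> r k + L / 2 * (norm (r k))\<^sup>2"
    using quadratic_upper_bound[OF grad lip, of "b - B *v z k" "A *v x k"]
    by (simp add: fx_eq gradient_eq eq)
  moreover have "L / 2 * (norm (r k))\<^sup>2 \<le> \<beta> / 2 * (norm (r k))\<^sup>2"
    using smooth_beta(3)[OF smooth params F grad lip] by (intro mult_right_mono) auto
  ultimately show ?thesis
    by (simp add: lag_def)
qed

text \<open>A solution exists, and \<open>value_le_lag\<close> compares the Lagrangian with costs of feasible points.\<close>

lemma lag_bounded_below: "\<exists>M. \<forall>k. M \<le> lag k"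
proof -
  obtain p where p: "p \<in> argmin (cost f g A B b)"
    using smooth by (auto simp: smooth_case_def)
  obtain xs zs where "p = (xs, zs)" by (cases p)
  then have "cost f g A B b p = f xs + g zs"
    using p by (auto simp: argmin_def cost_def split: if_splits)
  then have "cost f g A B b p \<noteq> -\<infinity>" "cost f g A B b p \<noteq> \<infinity>"
    using p f_bot[of xs] g_bot[of zs] by (auto simp: argmin_def)
  then obtain M where M: "cost f g A B b p = ereal M"
    by (cases "cost f g A B b p") auto
  have "M \<le> lag k" for k
  proof -
    have "ereal (M - gz k) \<le> epicomp A f (b - B *v z k)"
      unfolding epicomp_def
    proof (rule INF_greatest)
      fix x' assume "x' \<in> {x. A *v x = b - B *v z k}"
      then have "cost f g A B b (x', z k) = f x' + ereal (gz k)"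
        by (simp add: cost_def g_z)
      then have "ereal M \<le> f x' + ereal (gz k)"
        using p M unfolding argmin_def by (metis (mono_tags, lifting) mem_Collect_eq)
      then show "ereal (M - gz k) \<le> f x'"
        by (cases "f x'") auto
    qed
    then show ?thesis
      using value_le_lag[of k] by (simp add: F)
  qed
  then show ?thesis by blast
qed

text \<open>For each \<open>k\<close> some feasible point \<open>(x', z k)\<close> has cost at most \<open>lag 0 + 1\<close>; the slack \<open>1\<close> replaces
  attainment in the epicomposition. This bounds \<open>z\<close>, and everything else follows from it.\<close>

lemma bounded_iterates:
  assumes lev: "level_bounded (cost f g A B b)"
  shows "bounded (range y)" "bounded (range z)" "bounded (range (\<lambda>k. A *v x k))"
    and "bounded (range (\<lambda>k. B *v z k))" "bounded (range r)"
proof -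
  obtain M where M: "\<And>k. M \<le> lag k"
    using lag_bounded_below by blast
  have lag0: "lag k \<le> lag 0" for k
    using lag_mono[of 0 k] by simp
  show br: "bounded (range r)"
    using r_tendsto_0[of M] M by (intro convergent_imp_bounded) auto
  have "bounded (snd ` {p. cost f g A B b p \<le> ereal (lag 0 + 1)})"
    using lev by (intro bounded_snd) (simp add: level_bounded_def)
  moreover have "z k \<in> snd ` {p. cost f g A B b p \<le> ereal (lag 0 + 1)}" for k
  proof -
    have "epicomp A f (b - B *v z k) < ereal (F (b - B *v z k) + 1)"
      by (simp add: F)
    then obtain x' where x': "A *v x' = b - B *v z k" "f x' < ereal (F (b - B *v z k) + 1)"
      unfolding epicomp_def INF_less_iff by auto
    have "cost f g A B b (x', z k) = f x' + ereal (gz k)"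
      using x' by (simp add: cost_def g_z)
    also have "\<dots> \<le> ereal (F (b - B *v z k) + 1) + ereal (gz k)"
      using x' by (intro add_right_mono) simp
    also have "\<dots> \<le> ereal (lag 0 + 1)"
      using value_le_lag[of k] lag0[of k] by simp
    finally show ?thesis
      by (intro image_eqI[where x = "(x', z k)"]) auto
  qed
  ultimately show bz: "bounded (range z)"
    by (auto elim: bounded_subset)
  have "bounded ((*v) B ` range z)"
    using bz matrix_vector_mul_bounded_linear by (rule bounded_linear_image)
  then show bB: "bounded (range (\<lambda>k. B *v z k))"
    by (simp add: image_image)
  obtain K1 K2 where K: "\<And>k. norm (r k) \<le> K1" "\<And>k. norm (B *v z k) \<le> K2"
    using br bB unfolding bounded_iff by blast
  have Ax: "A *v x k = r k - B *v z k + b" for k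
    by (simp add: r_def resid_def)
  have "norm (A *v x k) \<le> K1 + K2 + norm b" for k
    unfolding Ax using K[of k] norm_triangle_ineq[of "r k - B *v z k" b] norm_triangle_ineq4[of "r k" "B *v z k"]
    by linarith
  then show bA: "bounded (range (\<lambda>k. A *v x k))"
    by (rule boundedI_seq)
  have "bounded (G ` range (\<lambda>k. A *v x k))"
    by (rule bounded_uniformly_continuous_image[OF _ bA])
      (rule lipschitz_on_uniformly_continuous[OF lipschitz_on_subset[OF lip subset_UNIV]])
  then have "bounded (uminus ` range y)"
    by (simp add: image_image gradient_eq)
  then show "bounded (range y)"
    by simp
qed

text \<open>A right inverse \<open>R\<close> of \<open>A\<close> repairs feasibility at a cost controlled by the residual: the gradient
  of \<open>f\<close> at \<open>x k\<close> is \<open>- A\<^sup>T y k\<close>, so moving by \<open>- R (r k)\<close> changes \<open>f\<close> by the term \<open>y k \<bullet> r k\<close> of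
  the Lagrangian and a bounded quadratic error.\<close>

lemma bounded_x:
  assumes lev: "level_bounded (cost f g A B b)" and f_grad: "lipschitz_gradient Lf f"
  shows "bounded (range x)"
proof -
  obtain Gf where fin: "\<And>s. \<bar>f s\<bar> \<noteq> \<infinity>"
    and gradf: "\<And>s. GDERIV (\<lambda>s. real_of_ereal (f s)) s :> Gf s" and lipf: "Lf-lipschitz_on UNIV Gf"
    using f_grad by (auto simp: lipschitz_gradient_def)
  define f' where "f' s = real_of_ereal (f s)" for s
  have f': "f s = ereal (f' s)" for s
    using fin[of s] by (auto simp: f'_def)
  have gradf': "GDERIV f' s :> Gf s" for s
    using gradf[of s] by (simp add: f'_def[abs_def])
  have Gf: "Gf (x k) = - (transpose A *v y k)" for k
  proof (rule gradient_eq_of_perturbed_min[OF gradf' lipf])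
    fix s
    have "\<beta> / 2 * (norm (A *v (s - x k)))\<^sup>2 \<le> \<beta> / 2 * (onorm ((*v) A) * norm (s - x k))\<^sup>2"
      using \<beta>_pos norm_mult_vec_le[of A "s - x k"] by (intro mult_left_mono power_mono) auto
    moreover have "f' (x k) \<le> f' s + (y k \<bullet> (A *v (s - x k)) + \<beta> / 2 * (norm (A *v (s - x k)))\<^sup>2)"
      using quad_min_x[of k] by (simp add: quad_min_def f' matrix_vector_mult_diff_distrib)
    ultimately show "f' (x k) \<le> f' s + (transpose A *v y k) \<bullet> (s - x k)
        + \<beta> / 2 * (onorm ((*v) A))\<^sup>2 * (norm (s - x k))\<^sup>2"
      unfolding transpose_inner by (simp add: power_mult_distrib mult.assoc)
  qed
  have "surj ((*v) A)"
    using smooth by (simp add: smooth_case_def)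
  then obtain R where R: "linear R" "\<And>s. A *v R s = s"
    using linear_surjective_right_inverse[of "(*v) A"] by (auto simp: fun_eq_iff)
  have "bounded (R ` range r)"
    using bounded_iterates(5)[OF lev] R(1) by (intro bounded_linear_image) (auto simp: linear_conv_bounded_linear)
  then obtain K where K: "\<And>k. norm (R (r k)) \<le> K"
    unfolding bounded_iff by blast
  have Lf: "Lf \<ge> 0" using lipf by (rule lipschitz_on_nonneg)
  let ?S = "{p. cost f g A B b p \<le> ereal (lag 0 + Lf / 2 * K\<^sup>2)}"
  have "bounded (fst ` ?S)"
    using lev by (intro bounded_fst) (simp add: level_bounded_def)
  then obtain K' where K': "\<And>s. s \<in> fst ` ?S \<Longrightarrow> norm s \<le> K'"
    unfolding bounded_iff by blast
  have "norm (x k) \<le> K' + K" for k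
  proof -
    define x' where "x' = x k - R (r k)"
    have "f' x' \<le> f' (x k) + Gf (x k) \<bullet> (x' - x k) + Lf / 2 * (norm (x' - x k))\<^sup>2"
      by (rule quadratic_upper_bound[OF gradf' lipf])
    also have "\<dots> = fx k + y k \<bullet> r k + Lf / 2 * (norm (R (r k)))\<^sup>2"
      by (simp add: Gf x'_def transpose_inner R f'_def fx_def del: transpose_matrix_vector)
    also have "\<dots> \<le> fx k + y k \<bullet> r k + Lf / 2 * K\<^sup>2"
      using Lf K[of k] by (intro add_left_mono mult_left_mono power_mono) auto
    finally have le: "f' x' \<le> fx k + y k \<bullet> r k + Lf / 2 * K\<^sup>2" .
    have "A *v x' + B *v z k = b"
      by (simp add: x'_def matrix_vector_mult_diff_distrib R) (simp add: r_def resid_def)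
    then have "cost f g A B b (x', z k) = ereal (f' x' + gz k)"
      by (simp add: cost_def g_z f')
    also have "f' x' + gz k \<le> lag 0 + Lf / 2 * K\<^sup>2"
    proof -
      have "0 \<le> \<beta> / 2 * (norm (r k))\<^sup>2"
        using \<beta>_pos by simp
      then show ?thesis
        using le lag_mono[of 0 k] unfolding lag_def[of k] by simp
    qed
    finally have "norm x' \<le> K'"
      by (intro K' image_eqI[where x = "(x', z k)"]) auto
    then show ?thesis
      using K[of k] norm_triangle_ineq[of x' "R (r k)"] by (simp add: x'_def)
  qed
  then show ?thesis
    by (rule boundedI_seq)
qed

end

lemma smooth_case_result:
  assumes smooth: "smooth_case f g A B b L" and params: "smooth_params f A L lam \<beta> c"
    and run: "ls_admm_run f g A B b 1 lam \<beta> c imax 0 xm ym zm x y z"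
  shows "summable (\<lambda>k. (norm (resid A B b (x k) (z k)))\<^sup>2) \<and>
        (\<exists>l::real.
           (\<lambda>k. aug_lag f g A B b \<beta> (x k) (z k) (y k)) \<longlonglongrightarrow> ereal l \<and>
           (lsc f \<and> lsc g \<longrightarrow>
             (\<forall>xc yc zc. cluster_point (\<lambda>k. (x k, y k, z k)) (xc, yc, zc) \<longrightarrow>
                kkt f g A B b xc yc zc \<and> f xc + g zc = ereal l))) \<and>
        (level_bounded (cost f g A B b) \<longrightarrow>
           bounded (range (\<lambda>k. (A *v x k, y k, B *v z k))) \<and>
           ((\<exists>Lf. lipschitz_gradient Lf f) \<longrightarrow> bounded (range (\<lambda>k. (x k, y k, z k)))))"
proof -
  obtain G where fin: "\<And>s. \<bar>epicomp A f s\<bar> \<noteq> \<infinity>" and lip: "L-lipschitz_on UNIV G"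
    and grad: "\<And>s. GDERIV (\<lambda>s. real_of_ereal (epicomp A f s)) s :> G s"
    using smooth by (auto simp: smooth_case_def lipschitz_gradient_def)
  define F where "F s = real_of_ereal (epicomp A f s)" for s
  have F: "epicomp A f s = ereal (F s)" for s
    using fin[of s] by (auto simp: F_def)
  have grad: "GDERIV F s :> G s" for s
    using grad[of s] by (simp add: F_def[abs_def])
  note ctxt = smooth params F grad lip
  interpret smooth_admm_descent f g A B b \<beta> c x y z L lam F G
  proof
    show "\<exists>yt zt. (x k, y k, z k) \<in> admm f g A B b \<beta> yt zt" for k
      by (rule ls_admm_run_admm[OF run])
    show "ls_accept f g A B b 1 \<beta> c (x k, y k, z k) (x (Suc k), y (Suc k), z (Suc k))" for k
      by (rule ls_admm_run_accept[OF run smooth_beta(2)[OF ctxt] smooth_nominal[OF ctxt]])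
    show "0 < c"
      using params unfolding smooth_params_def by blast
  qed (use ctxt smooth_bot[OF ctxt] smooth_beta[OF ctxt] in auto)
  obtain M where M: "\<And>k. M \<le> 1 * lag k"
    using lag_bounded_below by auto
  obtain l where l: "lag \<longlonglongrightarrow> l"
    using lag_convergent[OF M] by (auto simp: convergent_def)
  show ?thesis
  proof (intro conjI exI[of _ l] impI allI)
    show "summable (\<lambda>k. (norm (resid A B b (x k) (z k)))\<^sup>2)"
      using summable_resid[OF M] by (simp add: r_def)
    show "(\<lambda>k. aug_lag f g A B b \<beta> (x k) (z k) (y k)) \<longlonglongrightarrow> ereal l"
      using l by (simp add: aug_lag_eq)
  next
    fix xc yc zc
    assume lsc: "lsc f \<and> lsc g" and cl: "cluster_point (\<lambda>k. (x k, y k, z k)) (xc, yc, zc)"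
    note ck = cluster_point_kkt[OF conjunct1[OF lsc] conjunct2[OF lsc] r_tendsto_0[OF M] cl]
    show "kkt f g A B b xc yc zc" by (rule ck(1))
    obtain \<phi> :: "nat \<Rightarrow> nat" where \<phi>: "strict_mono \<phi>"
      and lim: "(\<lambda>k. ereal (lag (\<phi> k))) \<longlonglongrightarrow> f xc + g zc"
      using ck(2) by blast
    have "(\<lambda>k. ereal (lag (\<phi> k))) \<longlonglongrightarrow> ereal l"
      using LIMSEQ_subseq_LIMSEQ[OF l \<phi>] by (simp add: o_def)
    with lim show "f xc + g zc = ereal l"
      by (rule LIMSEQ_unique)
  next
    assume lev: "level_bounded (cost f g A B b)"
    show "bounded (range (\<lambda>k. (A *v x k, y k, B *v z k)))"
      by (intro bounded_seq_Pair bounded_iterates[OF lev])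
    assume "\<exists>Lf. lipschitz_gradient Lf f"
    then show "bounded (range (\<lambda>k. (x k, y k, z k)))"
      by (auto intro!: bounded_seq_Pair bounded_iterates[OF lev] bounded_x[OF lev])
  qed
qed

section \<open>Perturbed values and the dual cost\<close>

text \<open>A convex function that is finite near a point is bounded above near that point: bound it
  at the finitely many points \<open>b \<plusminus> \<epsilon>0 i\<close> with \<open>i\<close> in an orthonormal basis of \<open>M\<close>, and write a nearby
  point as an average of points on the segments between them.\<close>

lemma convex_set_locally_bounded:
  fixes T :: "('a::euclidean_space \<times> real) set"
  assumes T: "convex T" and up: "\<And>s t t'. (s, t) \<in> T \<Longrightarrow> t \<le> t' \<Longrightarrow> (s, t') \<in> T"
    and M: "subspace M" and "\<epsilon>0 > 0"
    and fin: "\<And>e. e \<in> M \<Longrightarrow> norm e \<le> \<epsilon>0 \<Longrightarrow> \<exists>t. (b + e, t) \<in> T"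
  shows "\<exists>\<epsilon>>0. \<exists>K. \<forall>e\<in>M. norm e \<le> \<epsilon> \<longrightarrow> (b + e, K) \<in> T"
proof -
  obtain Bs where Bs: "Bs \<subseteq> M" "pairwise orthogonal Bs" "\<And>i. i \<in> Bs \<Longrightarrow> norm i = 1"
    "independent Bs" "span Bs = M"
    using orthonormal_basis_subspace[OF M] by metis
  have "finite Bs" using Bs(4) by (rule independent_imp_finite)
  \<comment> \<open>\<open>0\<close> is included for the case \<open>M = {0}\<close>, in which the basis is empty\<close>
  define V where "V = insert 0 ((\<lambda>i. \<epsilon>0 *\<^sub>R i) ` Bs \<union> (\<lambda>i. - \<epsilon>0 *\<^sub>R i) ` Bs)"
  have "\<exists>t. (b + e, t) \<in> T" if "e \<in> V" for e
  proof (rule fin)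
    show "e \<in> M"
      using that Bs(1) M by (auto simp: V_def subspace_0 intro!: subspace_mul subspace_neg)
    show "norm e \<le> \<epsilon>0"
      using that Bs(3) \<open>\<epsilon>0 > 0\<close> by (auto simp: V_def)
  qed
  then obtain \<tau> where \<tau>: "\<And>e. e \<in> V \<Longrightarrow> (b + e, \<tau> e) \<in> T" by metis
  define K where "K = Max (\<tau> ` V)"
  define C where "C = {e. (b + e, K) \<in> T}"
  have V: "V \<subseteq> C"
  proof
    fix e assume "e \<in> V"
    moreover have "finite V" using \<open>finite Bs\<close> by (simp add: V_def)
    ultimately have "\<tau> e \<le> K" by (simp add: K_def)
    then show "e \<in> C" using up \<tau>[OF \<open>e \<in> V\<close>] by (simp add: C_def)
  qed
  have C: "convex C"
  proof (rule convexI)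
    fix e e' and u v :: real
    assume e: "e \<in> C" "e' \<in> C" and uv: "0 \<le> u" "0 \<le> v" "u + v = 1"
    have "u *\<^sub>R (b + e, K) + v *\<^sub>R (b + e', K) \<in> T"
      by (rule convexD[OF T]) (use e uv in \<open>auto simp: C_def\<close>)
    moreover have "u *\<^sub>R (b + e, K) + v *\<^sub>R (b + e', K) = ((u + v) *\<^sub>R b + (u *\<^sub>R e + v *\<^sub>R e'), (u + v) * K)"
      by (simp add: algebra_simps)
    ultimately show "u *\<^sub>R e + v *\<^sub>R e' \<in> C"
      using uv by (simp add: C_def)
  qed
  show ?thesis
  proof (cases "Bs = {}")
    case True
    then have "M = {0}" using Bs(5) by simp
    then show ?thesis
      using V by (intro exI[of _ 1]) (auto simp: V_def C_def)
  next
    case False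
    define n where "n = real (card Bs)"
    have n: "n > 0" using False \<open>finite Bs\<close> by (simp add: n_def card_gt_0_iff)
    have "e \<in> C" if e: "e \<in> M" "norm e \<le> \<epsilon>0 / n" for e
    proof -
      have "(\<Sum>i\<in>Bs. (1 / n) *\<^sub>R ((n * (e \<bullet> i)) *\<^sub>R i)) \<in> C"
      proof (rule convex_sum[OF \<open>finite Bs\<close> C])
        show "(\<Sum>i\<in>Bs. 1 / n) = 1" using n by (simp add: n_def)
        show "0 \<le> 1 / n" for i using n by simp
        fix i assume i: "i \<in> Bs"
        have "\<bar>n * (e \<bullet> i)\<bar> \<le> n * (norm e * norm i)"
          using n Cauchy_Schwarz_ineq2[of e i] by (simp add: abs_mult)
        also have "\<dots> \<le> \<epsilon>0"
          using e(2) n Bs(3)[OF i] by (simp add: pos_le_divide_eq mult.commute)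
        finally have le: "\<bar>n * (e \<bullet> i)\<bar> \<le> \<epsilon>0" .
        define p where "p = n * (e \<bullet> i) / \<epsilon>0"
        have p: "-1 \<le> p" "p \<le> 1" "n * (e \<bullet> i) = p * \<epsilon>0"
          using le \<open>\<epsilon>0 > 0\<close> by (auto simp: p_def abs_le_iff pos_divide_le_eq pos_le_divide_eq)
        have "((1 + p) / 2) *\<^sub>R (\<epsilon>0 *\<^sub>R i) + ((1 - p) / 2) *\<^sub>R (- \<epsilon>0 *\<^sub>R i) \<in> C"
          using V i p by (intro convexD[OF C]) (auto simp: V_def field_simps)
        moreover have "((1 + p) / 2) *\<^sub>R (\<epsilon>0 *\<^sub>R i) + ((1 - p) / 2) *\<^sub>R (- \<epsilon>0 *\<^sub>R i)
            = (((1 + p) / 2) * \<epsilon>0 + ((1 - p) / 2) * (- \<epsilon>0)) *\<^sub>R i"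
          unfolding scaleR_scaleR scaleR_add_left[symmetric] ..
        moreover have "((1 + p) / 2) * \<epsilon>0 + ((1 - p) / 2) * (- \<epsilon>0) = p * \<epsilon>0"
          by (simp add: field_simps)
        ultimately show "(n * (e \<bullet> i)) *\<^sub>R i \<in> C"
          by (simp add: p)
      qed
      also have "(\<Sum>i\<in>Bs. (1 / n) *\<^sub>R ((n * (e \<bullet> i)) *\<^sub>R i)) = (\<Sum>i\<in>Bs. (e \<bullet> i) *\<^sub>R i)"
        using n by simp
      also have "\<dots> = e"
        using Bs e \<open>finite Bs\<close> by (intro orthonormal_basis_expand) auto
      finally show ?thesis .
    qed
    then show ?thesis
      using n \<open>\<epsilon>0 > 0\<close> by (intro exI[of _ "\<epsilon>0 / n"]) (auto simp: C_def)
  qed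
qed

text \<open>The values reached in the perturbed problems \<open>A x + v = s\<close>: up to attainment, the epigraph of the
  value function of the perturbation \<open>s\<close>.\<close>

definition value_epi :: "(real^'m \<Rightarrow> ereal) \<Rightarrow> real^'m^'p \<Rightarrow> (real^'p \<Rightarrow> ereal) \<Rightarrow> ((real^'p) \<times> real) set"
  where "value_epi f A h = {(A *v x + v, t) | x v t. f x + h v \<le> ereal t}"

lemma value_epiE:
  assumes "(s, t) \<in> value_epi f A h" and "\<And>x. f x \<noteq> -\<infinity>" "\<And>v. h v \<noteq> -\<infinity>"
  obtains x v a q where "s = A *v x + v" "f x = ereal a" "h v = ereal q" "a + q \<le> t"
proof -
  obtain x v where s: "s = A *v x + v" and le: "f x + h v \<le> ereal t"
    using assms(1) by (auto simp: value_epi_def)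
  then show thesis
    using assms(2)[of x] assms(3)[of v] that[of x v] by (cases "f x"; cases "h v") auto
qed

lemma convex_value_epi:
  assumes f: "econvex f" "\<And>x. f x \<noteq> -\<infinity>" and h: "econvex h" "\<And>v. h v \<noteq> -\<infinity>"
  shows "convex (value_epi f A h)"
proof (rule convexI)
  fix P P' and u s :: real
  assume P: "P \<in> value_epi f A h" "P' \<in> value_epi f A h" and us: "0 \<le> u" "0 \<le> s" "u + s = 1"
  obtain x v a q where 1: "fst P = A *v x + v" "f x = ereal a" "h v = ereal q" "a + q \<le> snd P"
    by (rule value_epiE[OF _ f(2) h(2), of "fst P" "snd P"]) (use P(1) in auto)
  obtain x' v' a' q' where 2: "fst P' = A *v x' + v'" "f x' = ereal a'" "h v' = ereal q'" "a' + q' \<le> snd P'"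
    by (rule value_epiE[OF _ f(2) h(2), of "fst P'" "snd P'"]) (use P(2) in auto)
  have u: "u = 1 - s" using us by simp
  have "f ((1 - s) *\<^sub>R x + s *\<^sub>R x') \<le> ereal ((1 - s) * a + s * a')"
    using strongly_convex_segment[where h = f and \<sigma> = 0, of x a x' a' s] f us 1 2 by simp
  moreover have "h ((1 - s) *\<^sub>R v + s *\<^sub>R v') \<le> ereal ((1 - s) * q + s * q')"
    using strongly_convex_segment[where h = h and \<sigma> = 0, of v q v' q' s] h us 1 2 by simp
  ultimately have "f (u *\<^sub>R x + s *\<^sub>R x') + h (u *\<^sub>R v + s *\<^sub>R v')
      \<le> ereal (u * a + s * a') + ereal (u * q + s * q')"
    unfolding u by (rule add_mono)
  also have "\<dots> \<le> ereal (u * snd P + s * snd P')"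
  proof -
    have "u * (a + q) + s * (a' + q') \<le> u * snd P + s * snd P'"
      using us 1 2 by (intro add_mono mult_left_mono) auto
    then show ?thesis by (simp add: algebra_simps)
  qed
  finally have "(A *v (u *\<^sub>R x + s *\<^sub>R x') + (u *\<^sub>R v + s *\<^sub>R v'), u * snd P + s * snd P') \<in> value_epi f A h"
    unfolding value_epi_def by blast
  moreover have "A *v (u *\<^sub>R x + s *\<^sub>R x') + (u *\<^sub>R v + s *\<^sub>R v') = u *\<^sub>R fst P + s *\<^sub>R fst P'"
    by (simp add: 1 2 matrix_vector_right_distrib matrix_vector_mult_scaleR algebra_simps)
  moreover have "u *\<^sub>R P + s *\<^sub>R P' = (u *\<^sub>R fst P + s *\<^sub>R fst P', u * snd P + s * snd P')"
    by (simp add: prod_eq_iff)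
  ultimately show "u *\<^sub>R P + s *\<^sub>R P' \<in> value_epi f A h"
    by simp
qed

lemma fenchel_ge: "ereal (y \<bullet> x) - h x \<le> fenchel h y"
  unfolding fenchel_def by (rule SUP_upper) simp

text \<open>Weak duality for the perturbed problem. A finite value \<open>h v\<close> of the epicomposition need not be
  attained, hence the detour through the infimum.\<close>

lemma dual_cost_ge:
  assumes st: "(s, t) \<in> value_epi f A (epicomp B g)"
    and f: "\<And>x. f x \<noteq> -\<infinity>" and h: "\<And>v. epicomp B g v \<noteq> -\<infinity>"
  shows "ereal (- (y \<bullet> (s - b)) - t) \<le> dual_cost f g A B b y"
proof -
  obtain x v a q where s: "s = A *v x + v" and x: "f x = ereal a" and v: "epicomp B g v = ereal q"
    and t: "a + q \<le> t"
    by (rule value_epiE[OF st f h])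
  have 1: "ereal (- (y \<bullet> (A *v x)) - a) \<le> fenchel f (- (transpose A *v y))"
    using fenchel_ge[of "- (transpose A *v y)" x f]
    by (simp add: x transpose_inner del: transpose_matrix_vector)
  have 2: "ereal (- (y \<bullet> v) - q) \<le> fenchel g (- (transpose B *v y))" (is "_ \<le> ?G")
  proof -
    have ge: "ereal (- (y \<bullet> v)) - g z \<le> ?G" if "B *v z = v" for z
      using fenchel_ge[of "- (transpose B *v y)" z g] that
      by (simp add: transpose_inner del: transpose_matrix_vector)
    show ?thesis
    proof (cases ?G)
      case (real \<phi>)
      have "ereal (- (y \<bullet> v) - \<phi>) \<le> epicomp B g v"
        unfolding epicomp_def
      proof (rule INF_greatest)
        fix z assume "z \<in> {z. B *v z = v}"
        then show "ereal (- (y \<bullet> v) - \<phi>) \<le> g z"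
          using ge[of z] real by (cases "g z") auto
      qed
      then show ?thesis by (simp add: real v del: transpose_matrix_vector)
    next
      case MInf
      have "\<infinity> \<le> epicomp B g v"
        unfolding epicomp_def
      proof (rule INF_greatest)
        fix z assume "z \<in> {z. B *v z = v}"
        then show "\<infinity> \<le> g z"
          using ge[of z] MInf by (cases "g z") auto
      qed
      then show ?thesis by (simp add: v)
    qed simp
  qed
  have "ereal (- (y \<bullet> (s - b)) - t) \<le> ereal (- (y \<bullet> (A *v x)) - a) + ereal (- (y \<bullet> v) - q) + ereal (b \<bullet> y)"
    using t by (simp add: s inner_simps inner_commute)
  also have "\<dots> \<le> dual_cost f g A B b y"
    unfolding dual_cost_def by (intro add_mono 1 2 order_refl)
  finally show ?thesis .
qed

text \<open>The dual cost is a sum of two independent suprema, whereas the hypothesis bounds the joint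
  one. Fixing one reference point in each argument separates the bound, at the price of using
  it twice.\<close>

lemma dual_cost_le:
  assumes bound: "\<And>x z a q. f x = ereal a \<Longrightarrow> g z = ereal q \<Longrightarrow>
      - (y \<bullet> (A *v x + B *v z - b)) - a - q \<le> K"
    and f: "\<And>x. f x \<noteq> -\<infinity>" and g: "\<And>z. g z \<noteq> -\<infinity>"
    and x0: "f x0 = ereal a0" and z0: "g z0 = ereal q0"
  shows "dual_cost f g A B b y \<le> ereal (2 * K + a0 + q0 + y \<bullet> (A *v x0 + B *v z0 - b))"
proof -
  have "fenchel f (- (transpose A *v y)) \<le> ereal (K + q0 + y \<bullet> (B *v z0 - b))"
    unfolding fenchel_def
  proof (rule SUP_least)
    fix x show "ereal (- (transpose A *v y) \<bullet> x) - f x \<le> ereal (K + q0 + y \<bullet> (B *v z0 - b))"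
    proof (cases "f x")
      case (real a)
      then show ?thesis
        using bound[OF real z0]
        by (simp add: transpose_inner inner_simps del: transpose_matrix_vector)
    qed (use f in auto)
  qed
  moreover have "fenchel g (- (transpose B *v y)) \<le> ereal (K + a0 + y \<bullet> (A *v x0 - b))"
    unfolding fenchel_def
  proof (rule SUP_least)
    fix z show "ereal (- (transpose B *v y) \<bullet> z) - g z \<le> ereal (K + a0 + y \<bullet> (A *v x0 - b))"
    proof (cases "g z")
      case (real q)
      then show ?thesis
        using bound[OF x0 real]
        by (simp add: transpose_inner inner_simps del: transpose_matrix_vector)
    qed (use g in auto)
  qed
  ultimately have "dual_cost f g A B b y \<le> ereal (K + q0 + y \<bullet> (B *v z0 - b))
      + ereal (K + a0 + y \<bullet> (A *v x0 - b)) + ereal (b \<bullet> y)"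
    unfolding dual_cost_def by (intro add_mono order_refl)
  also have "\<dots> = ereal (2 * K + a0 + q0 + y \<bullet> (A *v x0 + B *v z0 - b))"
    by (simp add: inner_simps inner_commute)
  finally show ?thesis .
qed

section \<open>The strongly convex case\<close>

context
  fixes f :: "real^'m \<Rightarrow> ereal" and g :: "real^'n \<Rightarrow> ereal"
    and A :: "real^'m^'p" and B :: "real^'n^'p" and b :: "real^'p"
    and \<mu> lam \<beta> c :: real
  assumes sc: "strongly_convex_case f g A B b \<mu>" and params: "strongly_convex_params f A \<mu> lam \<beta> c"
begin

lemma sc_bot: "f s \<noteq> -\<infinity>" "g s' \<noteq> -\<infinity>" "epicomp B g s'' \<noteq> -\<infinity>"
  using sc by (simp_all add: strongly_convex_case_def proper_def)

lemma sc_pos: "\<mu> > 0" "\<beta> > 0" "c > 0" "\<beta> * (onorm ((*v) A))\<^sup>2 < \<mu>"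
  using sc params
  by (simp_all add: strongly_convex_case_def strongly_convex_def strongly_convex_params_def)

text \<open>The quadratic remainder of \<open>quad_min\<close> is absorbed by convexity, and strong convexity leaves
  growth behind.\<close>

lemma x_growth:
  assumes min: "quad_min f A y \<beta> x" and x: "f x = ereal a" and x': "f x' = ereal a'"
  shows "a + \<mu> / 2 * (norm (x' - x))\<^sup>2 \<le> a' + y \<bullet> (A *v x' - A *v x)"
proof -
  have "a + \<mu> / 2 * (norm (x' - x))\<^sup>2 \<le> a' + (transpose A *v y) \<bullet> (x' - x)"
  proof (rule growth_of_perturbed_min[OF _ x x'])
    show "econvex (\<lambda>x. f x - ereal (\<mu> / 2 * (norm x)\<^sup>2))"
      using sc by (simp add: strongly_convex_case_def strongly_convex_def)
    fix s
    have "\<beta> / 2 * (norm (A *v (s - x)))\<^sup>2 \<le> \<beta> / 2 * (onorm ((*v) A) * norm (s - x))\<^sup>2"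
      using sc_pos norm_mult_vec_le[of A "s - x"] by (intro mult_left_mono power_mono) auto
    moreover have "f x \<le> f s + ereal (y \<bullet> (A *v (s - x)) + \<beta> / 2 * (norm (A *v (s - x)))\<^sup>2)"
      using min by (simp add: quad_min_def matrix_vector_mult_diff_distrib)
    ultimately show "f x \<le> f s + ereal ((transpose A *v y) \<bullet> (s - x)
        + \<beta> / 2 * (onorm ((*v) A))\<^sup>2 * (norm (s - x))\<^sup>2)"
      unfolding transpose_inner
      by (elim order_trans) (auto intro!: add_left_mono simp: power_mult_distrib mult.assoc)
  qed
  then show ?thesis
    unfolding transpose_inner by (simp add: matrix_vector_mult_diff_distrib)
qed

lemma z_linear_min:
  assumes min: "quad_min g B w \<beta> z" and z: "g z = ereal q" and v: "epicomp B g v = ereal q'"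
  shows "q \<le> q' + w \<bullet> (v - B *v z)"
proof -
  have "q + 0 / 2 * (norm (v - B *v z))\<^sup>2 \<le> q' + w \<bullet> (v - B *v z)"
  proof (rule growth_of_perturbed_min[where h = "epicomp B g"])
    show "epicomp B g (B *v z) = ereal q"
      using quad_min_epicomp(1)[OF min] z by simp
    show "epicomp B g v = ereal q'" by (rule v)
    show "econvex (\<lambda>x. epicomp B g x - ereal (0 / 2 * (norm x)\<^sup>2))"
      using sc by (simp add: strongly_convex_case_def)
    show "epicomp B g (B *v z) \<le> epicomp B g s + ereal (w \<bullet> (s - B *v z) + \<beta> / 2 * (norm (s - B *v z))\<^sup>2)" for s
      using quad_min_epicomp[OF min] by simp
  qed
  then show ?thesis by simp
qed

text \<open>An instance of \<open>douglas_rachford_decrease\<close> for the dual function: \<open>u = y\<close>, \<open>w = y + \<beta> r\<close>, value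
  \<open>- f x - y \<bullet> A x\<close>, gradient \<open>- A x\<close>, stepsize parameter \<open>1 / \<beta>\<close> and \<open>L = |A|\<^sup>2 / \<mu>\<close>. Smoothness and
  cocoercivity of the dual function are consequences of \<open>x_growth\<close> at the two triplets.\<close>

lemma sc_nominal:
  assumes w: "(x, y, z) \<in> admm f g A B b \<beta> yt zt"
    and w': "p \<in> admm f g A B b \<beta> (y - (\<beta> * (1 - lam)) *\<^sub>R resid A B b x z) z"
  shows "ls_accept f g A B b (- 1) \<beta> c (x, y, z) p"
proof -
  obtain x' y' z' where p: "p = (x', y', z')"
    by (cases p)
  define r r' where "r = resid A B b x z" and "r' = resid A B b x' z'"
  note d = admmD[OF w sc_bot(1,2)] and d' = admmD[OF w'[unfolded p] sc_bot(1,2)]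
  obtain a a' q q' where val: "f x = ereal a" "f x' = ereal a'" "g z = ereal q" "g z' = ereal q'"
    using d d' by (auto simp: quad_min_def)
  have y': "y' = y - (\<beta> * (1 - lam)) *\<^sub>R r + \<beta> *\<^sub>R (A *v x' + B *v z - b)"
    using d'(3) by (simp add: r_def)
  define N where "N = onorm ((*v) A)"
  define \<omega> where "\<omega> = y + \<beta> *\<^sub>R r"
  have \<beta>: "\<beta> > 0" and \<mu>: "\<mu> > 0" by (rule sc_pos)+
  have g1: "a + \<mu> / 2 * (norm (x' - x))\<^sup>2 \<le> a' + y \<bullet> (A *v x' - A *v x)"
    by (rule x_growth[OF d(1) val(1,2)])
  have g2: "a' + \<mu> / 2 * (norm (x' - x))\<^sup>2 \<le> a + y' \<bullet> (A *v x - A *v x')"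
    using x_growth[OF d'(1) val(2,1)] by (simp add: norm_minus_commute)
  have NA: "norm (A *v x' - A *v x) \<le> N * norm (x' - x)"
    using norm_mult_vec_le[of A "x' - x"] by (simp add: N_def matrix_vector_mult_diff_distrib)
  have lipx: "\<mu> * norm (x' - x) \<le> N * norm (y' - y)"
  proof (cases "x' = x")
    case True
    have "0 \<le> N" unfolding N_def by (rule onorm_pos_le) (rule matrix_vector_mul_bounded_linear)
    then show ?thesis using True by simp
  next
    case False
    have "\<mu> * (norm (x' - x))\<^sup>2 \<le> (y - y') \<bullet> (A *v x' - A *v x)"
      using g1 g2 by (simp add: inner_diff_right inner_diff_left)
    also have "\<dots> \<le> norm (y - y') * norm (A *v x' - A *v x)"
      by (rule norm_cauchy_schwarz)
    also have "\<dots> \<le> norm (y' - y) * (N * norm (x' - x))"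
      unfolding norm_minus_commute[of y y'] using NA by (intro mult_left_mono) auto
    finally show ?thesis
      using False by (simp add: power2_eq_square mult.commute)
  qed
  have gap: "a' - a + y \<bullet> (A *v x' - A *v x)
      = (- a - y \<bullet> (A *v x)) - (- a' - y' \<bullet> (A *v x')) - (- (A *v x')) \<bullet> (y - y')"
    by (simp add: inner_simps inner_commute)
  have gap_ge: "\<mu> / 2 * (norm (x' - x))\<^sup>2 \<le> a' - a + y \<bullet> (A *v x' - A *v x)"
    using g1 by simp
  have gap0: "0 \<le> a' - a + y \<bullet> (A *v x' - A *v x)"
  proof -
    have "0 \<le> \<mu> / 2 * (norm (x' - x))\<^sup>2" using \<mu> by simp
    then show ?thesis using gap_ge by linarith
  qed
  have "(- a' - y' \<bullet> (A *v x')) + (- (A *v x')) \<bullet> (\<omega> - y') + (1 / \<beta>) / 2 * (norm (\<omega> - y'))\<^sup>2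
    \<le> (- a - y \<bullet> (A *v x)) + (- (A *v x)) \<bullet> (\<omega> - y) + (1 / \<beta>) / 2 * (norm (\<omega> - y))\<^sup>2
      - (1 / \<beta>) * c * (norm (\<omega> - y))\<^sup>2"
  proof (rule douglas_rachford_decrease[where lam = lam and L = "N\<^sup>2 / \<mu>" and cvx = True])
    show "(1 / \<beta>) *\<^sub>R (y' - y) + (- (A *v x') - - (A *v x)) = (1 / \<beta> * lam) *\<^sub>R (\<omega> - y)"
      unfolding y' \<omega>_def r_def resid_def using \<beta> by (simp add: algebra_simps)
    have "norm (- (A *v x') - - (A *v x)) = norm (A *v x' - A *v x)"
      by (simp add: norm_minus_commute)
    also have "\<dots> \<le> N * (N * norm (y' - y) / \<mu>)"
    proof -
      have "0 \<le> N" unfolding N_def by (rule onorm_pos_le) (rule matrix_vector_mul_bounded_linear)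
      moreover have "norm (x' - x) \<le> N * norm (y' - y) / \<mu>"
        using lipx \<mu> by (simp add: pos_le_divide_eq mult.commute)
      ultimately show ?thesis
        using NA by (meson mult_left_mono order_trans)
    qed
    finally show "norm (- (A *v x') - - (A *v x)) \<le> N\<^sup>2 / \<mu> * norm (y' - y)"
      by (simp add: power2_eq_square)
    show "- (N\<^sup>2 / \<mu> / 2) * (norm (y' - y))\<^sup>2
      \<le> (- a - y \<bullet> (A *v x)) - (- a' - y' \<bullet> (A *v x')) - (- (A *v x')) \<bullet> (y - y')"
    proof -
      have "0 \<le> N\<^sup>2 / \<mu> / 2 * (norm (y' - y))\<^sup>2" using \<mu> by simp
      then show ?thesis using gap gap0 by linarith
    qed
    show "0 \<le> (- a - y \<bullet> (A *v x)) - (- a' - y' \<bullet> (A *v x')) - (- (A *v x')) \<bullet> (y - y')"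
      using gap gap0 by simp
    have "(norm (- (A *v x') - - (A *v x)))\<^sup>2 = (norm (A *v x' - A *v x))\<^sup>2"
      by (simp add: norm_minus_commute)
    also have "\<dots> \<le> (N * norm (x' - x))\<^sup>2"
      using NA by (intro power_mono) auto
    also have "\<dots> = 2 * (N\<^sup>2 / \<mu>) * (\<mu> / 2 * (norm (x' - x))\<^sup>2)"
      using \<mu> by (simp add: power_mult_distrib)
    also have "\<dots> \<le> 2 * (N\<^sup>2 / \<mu>) * (a' - a + y \<bullet> (A *v x' - A *v x))"
      using gap_ge \<mu> by (intro mult_left_mono) auto
    finally show "(norm (- (A *v x') - - (A *v x)))\<^sup>2
      \<le> 2 * (N\<^sup>2 / \<mu>) * ((- a - y \<bullet> (A *v x)) - (- a' - y' \<bullet> (A *v x')) - (- (A *v x')) \<bullet> (y - y'))"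
      unfolding gap .
  next
    show "c \<le> lam / (1 + N\<^sup>2 / \<mu> / (1 / \<beta>))\<^sup>2 * ((2 - lam) / 2 -
        N\<^sup>2 / \<mu> / (1 / \<beta>) * (if True then max (N\<^sup>2 / \<mu> / (1 / \<beta>) - lam / 2) 0 else 1))"
    proof -
      define \<alpha> where "\<alpha> = \<beta> * N\<^sup>2 / \<mu>"
      have lam: "0 < lam" using params by (simp add: strongly_convex_params_def)
      have \<alpha>: "0 \<le> \<alpha>" "\<alpha> < 1"
        using sc_pos by (auto simp: \<alpha>_def N_def)
      have "c \<le> lam / (1 + \<alpha>)\<^sup>2 * ((2 - lam) / 2 -
          \<alpha> * (if econvex (epicomp A f) then max (\<alpha> - lam / 2) 0 else 1))"
        using params unfolding strongly_convex_params_def admm_const_def \<alpha>_def N_def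
        by (blast intro: less_imp_le)
      \<comment> \<open>since \<open>\<alpha> < 1\<close>, the nonconvex constant is the smaller one\<close>
      also have "\<dots> \<le> lam / (1 + \<alpha>)\<^sup>2 * ((2 - lam) / 2 - \<alpha> * max (\<alpha> - lam / 2) 0)"
        using \<alpha> lam by (intro mult_left_mono diff_left_mono) auto
      finally show ?thesis
        by (simp add: \<alpha>_def mult.commute)
    qed
    show "0 < lam" "lam < 2" "0 < c"
      using params by (simp_all add: strongly_convex_params_def)
  qed (use \<beta> \<mu> in auto)
  moreover have "\<omega> - y = \<beta> *\<^sub>R r"
    by (simp add: \<omega>_def)
  ultimately have "(- a' - y' \<bullet> (A *v x')) + (- (A *v x')) \<bullet> (\<omega> - y') + (1 / \<beta>) / 2 * (norm (\<omega> - y'))\<^sup>2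
    \<le> (- a - y \<bullet> (A *v x)) + (- (A *v x)) \<bullet> (\<beta> *\<^sub>R r) + (1 / \<beta>) / 2 * (norm (\<beta> *\<^sub>R r))\<^sup>2
      - (1 / \<beta>) * c * (norm (\<beta> *\<^sub>R r))\<^sup>2"
    by simp
  also have "\<dots> = - a - y \<bullet> (A *v x) - \<beta> * ((A *v x) \<bullet> r) + \<beta> / 2 * (norm r)\<^sup>2 - \<beta> * c * (norm r)\<^sup>2"
    using \<beta> by (simp add: power_mult_distrib power2_eq_square)
  also have "\<dots> = q + \<omega> \<bullet> (B *v z - b) - (a + q + y \<bullet> r + \<beta> / 2 * (norm r)\<^sup>2) - \<beta> * c * (norm r)\<^sup>2"
  proof -
    have Bz: "B *v z - b = r - A *v x" by (simp add: r_def resid_def)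
    show ?thesis
      unfolding Bz \<omega>_def power2_norm_eq_inner
      by (simp add: inner_simps inner_commute algebra_simps)
  qed
  also have "\<dots> \<le> q' + \<omega> \<bullet> (B *v z' - b) - (a + q + y \<bullet> r + \<beta> / 2 * (norm r)\<^sup>2) - \<beta> * c * (norm r)\<^sup>2"
  proof -
    have "q \<le> q' + \<omega> \<bullet> (B *v z' - B *v z)"
    proof (rule z_linear_min)
      show "quad_min g B \<omega> \<beta> z" using d(2) by (simp add: \<omega>_def r_def)
      show "epicomp B g (B *v z') = ereal q'"
        using quad_min_epicomp(1)[OF d'(2)] val by simp
    qed (rule val)
    then show ?thesis by (simp add: inner_simps)
  qed
  finally have "- a' - q' - y' \<bullet> (A *v x') - (A *v x') \<bullet> (\<omega> - y') + (1 / \<beta>) / 2 * (norm (\<omega> - y'))\<^sup>2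
      - \<omega> \<bullet> (B *v z' - b) \<le> - (a + q + y \<bullet> r + \<beta> / 2 * (norm r)\<^sup>2) - \<beta> * c * (norm r)\<^sup>2"
    by simp
  moreover have "- (a' + q' + y' \<bullet> r' + \<beta> / 2 * (norm r')\<^sup>2)
    \<le> - a' - q' - y' \<bullet> (A *v x') - (A *v x') \<bullet> (\<omega> - y') + (1 / \<beta>) / 2 * (norm (\<omega> - y'))\<^sup>2
      - \<omega> \<bullet> (B *v z' - b)"
  proof -
    define e where "e = \<omega> - y'"
    have Bz: "B *v z' - b = r' - A *v x'" and \<omega>: "\<omega> = y' + e"
      by (simp_all add: r'_def resid_def e_def)
    have "0 \<le> (1 / \<beta>) / 2 * (norm (e - \<beta> *\<^sub>R r'))\<^sup>2"
      using \<beta> by simp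
    also have "\<dots> = (1 / \<beta>) / 2 * (norm e)\<^sup>2 - e \<bullet> r' + \<beta> / 2 * (norm r')\<^sup>2"
      unfolding power2_norm_eq_inner using \<beta>
      by (simp add: inner_simps inner_commute field_simps)
    finally show ?thesis
      unfolding Bz \<omega> by (simp add: inner_simps inner_commute)
  qed
  ultimately have "a + q + (y \<bullet> r + \<beta> / 2 * (norm r)\<^sup>2) + \<beta> * c * (norm r)\<^sup>2
      \<le> a' + q' + (y' \<bullet> r' + \<beta> / 2 * (norm r')\<^sup>2)"
    by linarith
  then show ?thesis
    by (simp add: ls_accept_def p aug_lag_def val flip: r_def r'_def)
qed

end

lemma image_dom_sumI:
  assumes "f x = ereal a" "g z = ereal q"
  shows "A *v x + B *v z \<in> image_dom_sum f g A B"
  unfolding image_dom_sum_def edom_def using assms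
  by (intro CollectI exI[of _ x] exI[of _ z]) auto

locale dual_admm_descent = admm_descent f g A B b "-1" \<beta> c x y z
  for f :: "real^'m \<Rightarrow> ereal" and g :: "real^'n \<Rightarrow> ereal"
    and A :: "real^'m^'p" and B :: "real^'n^'p" and b :: "real^'p" and \<beta> c :: real
    and x :: "nat \<Rightarrow> real^'m" and y :: "nat \<Rightarrow> real^'p" and z :: "nat \<Rightarrow> real^'n" +
  fixes \<mu> lam :: real
  assumes sc: "strongly_convex_case f g A B b \<mu>" and params: "strongly_convex_params f A \<mu> lam \<beta> c"
begin

definition w :: "nat \<Rightarrow> real^'p" where "w k = y k + \<beta> *\<^sub>R r k"

definition \<kappa> :: real where "\<kappa> = \<mu> - \<beta> * (onorm ((*v) A))\<^sup>2"

abbreviation T :: "((real^'p) \<times> real) set" where "T \<equiv> value_epi f A (epicomp B g)"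

lemma \<kappa>_pos: "\<kappa> > 0"
  using sc_pos(4)[OF sc params] by (simp add: \<kappa>_def)

text \<open>The sum of \<open>x_growth\<close> and \<open>z_linear_min\<close>. The mismatch of their multipliers \<open>y\<close> and \<open>y + \<beta> r\<close> leaves
  \<open>\<beta>/2 |r|\<^sup>2 + \<beta> r \<bullet> d\<close> with \<open>d = A (x' - x)\<close>; completing the square costs \<open>\<beta>/2 |d|\<^sup>2\<close>, which strong
  convexity pays for, with \<open>\<kappa>\<close> to spare.\<close>

lemma lag_growth:
  assumes f: "f x' = ereal a" and h: "epicomp B g v = ereal q"
  shows "lag k + \<kappa> / 2 * (norm (x' - x k))\<^sup>2 - w k \<bullet> (A *v x' + v - b) \<le> a + q"
proof -
  define d where "d = A *v x' - A *v x k"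
  have Ax': "A *v x' = A *v x k + d" and Bz: "B *v z k = b + r k - A *v x k"
    by (simp_all add: d_def r_def resid_def)
  have 1: "fx k + \<mu> / 2 * (norm (x' - x k))\<^sup>2 \<le> a + y k \<bullet> d"
    unfolding d_def by (rule x_growth[OF sc params quad_min_x f_x f])
  have 2: "gz k \<le> q + w k \<bullet> (v - B *v z k)"
    unfolding w_def by (rule z_linear_min[OF sc params quad_min_z g_z h])
  have "norm d \<le> onorm ((*v) A) * norm (x' - x k)"
    using norm_mult_vec_le[of A "x' - x k"] by (simp add: d_def matrix_vector_mult_diff_distrib)
  then have "\<beta> / 2 * (norm d)\<^sup>2 \<le> \<beta> / 2 * (onorm ((*v) A) * norm (x' - x k))\<^sup>2"
    using \<beta>_pos by (intro mult_left_mono power_mono) auto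
  then have 3: "\<kappa> / 2 * (norm (x' - x k))\<^sup>2 \<le> \<mu> / 2 * (norm (x' - x k))\<^sup>2 - \<beta> / 2 * (norm d)\<^sup>2"
    by (simp add: \<kappa>_def field_simps power_mult_distrib)
  have "0 \<le> \<beta> / 2 * (norm (r k + d))\<^sup>2"
    using \<beta>_pos by simp
  also have "\<dots> = \<beta> / 2 * (norm (r k))\<^sup>2 + \<beta> * (r k \<bullet> d) + \<beta> / 2 * (norm d)\<^sup>2"
    unfolding power2_norm_eq_inner by (simp add: inner_simps inner_commute algebra_simps)
  finally have 4: "0 \<le> \<beta> / 2 * (norm (r k))\<^sup>2 + \<beta> * (r k \<bullet> d) + \<beta> / 2 * (norm d)\<^sup>2" .
  have 5: "w k \<bullet> (v - B *v z k) - w k \<bullet> (A *v x' + v - b)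
      = - (y k \<bullet> d) - \<beta> * (r k \<bullet> d) - y k \<bullet> r k - \<beta> * (norm (r k))\<^sup>2"
    unfolding w_def Ax' Bz power2_norm_eq_inner
    by (simp add: inner_simps inner_commute algebra_simps)
  show ?thesis
    using 1 2 3 4 5 unfolding lag_def by (simp add: algebra_simps)
qed

lemma lag_le_of_mem: "(s, t) \<in> T \<Longrightarrow> lag k - w k \<bullet> (s - b) \<le> t"
proof -
  assume st: "(s, t) \<in> T"
  obtain x' v a q where *: "s = A *v x' + v" "f x' = ereal a" "epicomp B g v = ereal q" "a + q \<le> t"
    by (rule value_epiE[OF st sc_bot(1,3)[OF sc params]])
  have "0 \<le> \<kappa> / 2 * (norm (x' - x k))\<^sup>2"
    using \<kappa>_pos by simp
  then show ?thesis
    using lag_growth[OF *(2,3), of k] * by simp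
qed

lemma mem_T_point:
  assumes "f x' = ereal a" "g z' = ereal q"
  shows "(A *v x' + B *v z', a + q) \<in> T"
proof -
  have "f x' + epicomp B g (B *v z') \<le> ereal a + ereal q"
    using epicomp_le[of B g z'] assms by (intro add_mono) auto
  then show ?thesis
    unfolding value_epi_def by auto
qed

lemma mem_T_iterate: "(b + r k, fx k + gz k) \<in> T"
proof -
  have "b + r k = A *v x k + B *v z k"
    by (simp add: r_def resid_def)
  then show ?thesis
    using mem_T_point[OF f_x[of k] g_z[of k]] by simp
qed

lemma mem_T_mono:
  assumes "(s, t) \<in> T" "t \<le> t'"
  shows "(s, t') \<in> T"
proof -
  obtain x' v where s: "s = A *v x' + v" and le: "f x' + epicomp B g v \<le> ereal t"
    using assms(1) by (auto simp: value_epi_def)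
  have "f x' + epicomp B g v \<le> ereal t'"
    using le assms(2) by (meson ereal_less_eq(3) order_trans)
  then show ?thesis
    unfolding value_epi_def s by blast
qed

lemma convex_T: "convex T"
proof (rule convex_value_epi)
  have "econvex (\<lambda>x. f x - ereal (\<mu> / 2 * (norm x)\<^sup>2))" "\<mu> \<ge> 0"
    using sc by (simp_all add: strongly_convex_case_def strongly_convex_def)
  then show "econvex f"
    by (rule strongly_convex_imp_econvex)
  show "econvex (epicomp B g)"
    using sc by (simp add: strongly_convex_case_def)
qed (rule sc_bot[OF sc params])+

lemma mem_T_of_image_dom_sum:
  assumes "s \<in> image_dom_sum f g A B"
  shows "\<exists>t. (s, t) \<in> T"
proof -
  obtain x' z' where s: "s = A *v x' + B *v z'" and "f x' < \<infinity>" "g z' < \<infinity>"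
    using assms by (auto simp: image_dom_sum_def edom_def)
  then obtain a q where a: "f x' = ereal a" and q: "g z' = ereal q"
    using f_bot[of x'] g_bot[of z'] by (cases "f x'"; cases "g z'") auto
  show ?thesis
    unfolding s using mem_T_point[OF a q] by blast
qed

lemma iterate_in_image_dom_sum: "b + r k \<in> image_dom_sum f g A B"
proof -
  have "b + r k = A *v x k + B *v z k"
    by (simp add: r_def resid_def)
  then show ?thesis
    using image_dom_sumI[of f "x k" "fx k" g "z k" "gz k" A B] by (simp add: f_x g_z)
qed

lemma b_mem: "b \<in> image_dom_sum f g A B"
  using sc rel_interior_subset by (auto simp: strongly_convex_case_def)

definition opt :: real where "opt = real_of_ereal (INF p. cost f g A B b p)"

lemma cost_ge: "ereal (lag k) \<le> cost f g A B b p"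
proof (cases p)
  case (Pair x' z')
  show ?thesis
  proof (cases "A *v x' + B *v z' = b \<and> f x' < \<infinity> \<and> g z' < \<infinity>")
    case True
    then obtain a q where a: "f x' = ereal a" and q: "g z' = ereal q"
      using f_bot[of x'] g_bot[of z'] by (cases "f x'"; cases "g z'") auto
    have "(b, a + q) \<in> T"
      using mem_T_point[OF a q] True by simp
    then show ?thesis
      using lag_le_of_mem[of b "a + q" k] True by (simp add: Pair cost_def a q)
  next
    case False
    then have "cost f g A B b p = \<infinity>"
      using f_bot[of x'] g_bot[of z'] by (auto simp: Pair cost_def)
    then show ?thesis by simp
  qed
qed

lemma INF_cost: "(INF p. cost f g A B b p) = ereal opt"
proof -
  obtain x' z' where xz: "b = A *v x' + B *v z'" "f x' < \<infinity>" "g z' < \<infinity>"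
    using b_mem by (auto simp: image_dom_sum_def edom_def)
  have "(INF p. cost f g A B b p) \<le> cost f g A B b (x', z')"
    by (rule INF_lower) simp
  also have "\<dots> < \<infinity>"
    using xz by (simp add: cost_def)
  finally have "(INF p. cost f g A B b p) \<noteq> \<infinity>" by simp
  moreover have "ereal (lag 0) \<le> (INF p. cost f g A B b p)"
    by (intro INF_greatest cost_ge)
  ultimately show ?thesis
    unfolding opt_def by (cases "INF p. cost f g A B b p") auto
qed

lemma lag_le_opt: "lag k \<le> opt"
proof -
  have "ereal (lag k) \<le> (INF p. cost f g A B b p)"
    by (intro INF_greatest cost_ge)
  then show ?thesis by (simp add: INF_cost)
qed

lemma opt_le_of_mem:
  assumes "(b, t) \<in> T"
  shows "opt \<le> t"
proof -
  obtain x' v a q where *: "b = A *v x' + v" "f x' = ereal a" "epicomp B g v = ereal q" "a + q \<le> t"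
    by (rule value_epiE[OF assms sc_bot(1,3)[OF sc params]])
  have "ereal (opt - a) \<le> epicomp B g v"
    unfolding epicomp_def
  proof (rule INF_greatest)
    fix z' assume "z' \<in> {z. B *v z = v}"
    then have "cost f g A B b (x', z') = ereal a + g z'"
      using * by (simp add: cost_def)
    moreover have "ereal opt \<le> cost f g A B b (x', z')"
      unfolding INF_cost[symmetric] by (rule INF_lower) simp
    ultimately show "ereal (opt - a) \<le> g z'"
      by (cases "g z'") auto
  qed
  then show ?thesis using * by simp
qed

lemma r_tendsto_0': "r \<longlonglongrightarrow> 0"
  and summable_r: "summable (\<lambda>k. (norm (r k))\<^sup>2)"
  using r_tendsto_0[of "- opt"] summable_resid[of "- opt"] lag_le_opt by auto

lemma locally_bounded_T:
  assumes M: "subspace M" and "\<epsilon>0 > 0"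
    and "\<And>e. e \<in> M \<Longrightarrow> norm e \<le> \<epsilon>0 \<Longrightarrow> b + e \<in> image_dom_sum f g A B"
  obtains \<epsilon> K where "\<epsilon> > 0" "\<And>e. e \<in> M \<Longrightarrow> norm e \<le> \<epsilon> \<Longrightarrow> (b + e, K) \<in> T"
proof -
  have "\<exists>\<epsilon>>0. \<exists>K. \<forall>e\<in>M. norm e \<le> \<epsilon> \<longrightarrow> (b + e, K) \<in> T"
    by (rule convex_set_locally_bounded[OF convex_T mem_T_mono M \<open>\<epsilon>0 > 0\<close>])
      (use mem_T_of_image_dom_sum assms(3) in auto)
  then show thesis
    using that by blast
qed

text \<open>The directions from \<open>b\<close> inside the affine hull of the attainable right-hand sides: small ones
  keep the problem feasible, and every residual is one of them.\<close>

definition shifts :: "(real^'p) set" where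
  "shifts = {e. b + e \<in> affine hull (image_dom_sum f g A B)}"

lemma subspace_shifts: "subspace shifts"
proof -
  have "shifts = (\<lambda>s. - b + s) ` (affine hull (image_dom_sum f g A B))"
    by (force simp: shifts_def image_iff)
  moreover have "b \<in> affine hull (image_dom_sum f g A B)"
    using b_mem by (rule hull_inc)
  ultimately show ?thesis
    using affine_diffs_subspace[OF affine_affine_hull] by metis
qed

text \<open>Two uses of the uniform bound \<open>K\<close> around \<open>b\<close>. At \<open>b + (\<epsilon>/|r|) r\<close> it bounds \<open>- (w \<bullet> r)\<close> by a multiple
  of \<open>|r|\<close>, although \<open>w\<close> itself may be unbounded. At \<open>b - (\<epsilon>/|r|) r\<close> it provides a point that,
  averaged with the iterate at \<open>b + r\<close>, gives a feasible one; its weight is of order \<open>|r|\<close>.\<close>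

lemma lag_tendsto_opt: "lag \<longlonglongrightarrow> opt"
proof -
  let ?S = "image_dom_sum f g A B"
  obtain \<epsilon>0 where "\<epsilon>0 > 0" and \<epsilon>0: "cball b \<epsilon>0 \<inter> affine hull ?S \<subseteq> ?S"
    using sc by (auto simp: strongly_convex_case_def mem_rel_interior_cball)
  obtain \<epsilon> K where "\<epsilon> > 0" and K: "\<And>e. e \<in> shifts \<Longrightarrow> norm e \<le> \<epsilon> \<Longrightarrow> (b + e, K) \<in> T"
  proof (rule locally_bounded_T[OF subspace_shifts \<open>\<epsilon>0 > 0\<close>])
    show "b + e \<in> ?S" if "e \<in> shifts" "norm e \<le> \<epsilon>0" for e
      using that \<epsilon>0 by (auto simp: shifts_def dist_norm)
  qed blast
  define C where "C = (K - lag 0) / \<epsilon> + (K - opt) / \<epsilon>"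
  have lower: "opt - (C * norm (r k) + \<beta> / 2 * (norm (r k))\<^sup>2) \<le> lag k" for k
  proof (cases "r k = 0")
    case True
    then show ?thesis
      using opt_le_of_mem[of "fx k + gz k"] mem_T_iterate[of k] by (simp add: lag_def)
  next
    case False
    define \<rho> where "\<rho> = norm (r k)"
    have \<rho>: "\<rho> > 0" using False by (simp add: \<rho>_def)
    have rM: "r k \<in> shifts"
      using hull_inc[OF iterate_in_image_dom_sum[of k], of affine] by (simp add: shifts_def)
    have mem: "(b + (\<sigma> * \<epsilon> / \<rho>) *\<^sub>R r k, K) \<in> T" if "\<bar>\<sigma>\<bar> = 1" for \<sigma>
      using that rM subspace_shifts \<rho> \<open>\<epsilon> > 0\<close>
      by (intro K subspace_scale) (auto simp: \<rho>_def abs_mult)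
    have "lag k - (\<epsilon> / \<rho>) * (w k \<bullet> r k) \<le> K"
      using lag_le_of_mem[OF mem[of 1], of k] by simp
    moreover have "lag 0 \<le> lag k"
      using lag_mono[of 0 k] by simp
    ultimately have "- (\<epsilon> / \<rho>) * (w k \<bullet> r k) \<le> K - lag 0"
      by simp
    then have 1: "- (w k \<bullet> r k) \<le> (K - lag 0) / \<epsilon> * \<rho>"
      using \<rho> \<open>\<epsilon> > 0\<close> by (simp add: field_simps)
    have 2: "fx k + gz k = lag k - w k \<bullet> r k + \<beta> / 2 * \<rho>\<^sup>2"
      by (simp add: lag_def w_def \<rho>_def inner_simps power2_norm_eq_inner)
    \<comment> \<open>the weight at which the steps \<open>r k\<close> and \<open>- (\<epsilon> / \<rho>) r k\<close> cancel\<close>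
    define t where "t = \<rho> / (\<epsilon> + \<rho>)"
    have t: "0 \<le> t" "t \<le> 1" "1 - t = \<epsilon> / (\<epsilon> + \<rho>)"
      using \<rho> \<open>\<epsilon> > 0\<close> by (auto simp: t_def field_simps)
    have "(1 - t) *\<^sub>R (b + r k, fx k + gz k) + t *\<^sub>R (b + (- 1 * \<epsilon> / \<rho>) *\<^sub>R r k, K) \<in> T"
      using mem_T_iterate[of k] mem[of "-1"] t by (intro convexD[OF convex_T]) auto
    moreover have "(1 - t) *\<^sub>R (b + r k) + t *\<^sub>R (b + (- 1 * \<epsilon> / \<rho>) *\<^sub>R r k) = b"
    proof -
      have "(1 - t) *\<^sub>R (b + r k) + t *\<^sub>R (b + (- 1 * \<epsilon> / \<rho>) *\<^sub>R r k)
          = b + ((1 - t) - t * (\<epsilon> / \<rho>)) *\<^sub>R r k"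
        by (simp add: algebra_simps)
      also have "(1 - t) - t * (\<epsilon> / \<rho>) = 0"
        unfolding t(3) using \<rho> by (simp add: t_def)
      finally show ?thesis by simp
    qed
    ultimately have "opt \<le> (1 - t) * (fx k + gz k) + t * K"
      by (intro opt_le_of_mem) simp
    then have "(\<epsilon> + \<rho>) * opt \<le> (\<epsilon> + \<rho>) * ((1 - t) * (fx k + gz k) + t * K)"
      using \<rho> \<open>\<epsilon> > 0\<close> by (intro mult_left_mono) auto
    also have "\<dots> = ((\<epsilon> + \<rho>) * (1 - t)) * (fx k + gz k) + ((\<epsilon> + \<rho>) * t) * K"
      by (simp only: distrib_left mult.assoc)
    also have "\<dots> = \<epsilon> * (fx k + gz k) + \<rho> * K"
      unfolding t(3) using \<rho> \<open>\<epsilon> > 0\<close> by (simp add: t_def)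
    finally have "\<epsilon> * opt \<le> \<epsilon> * (fx k + gz k) + (K - opt) * \<rho>"
      by (simp add: algebra_simps)
    also have "\<dots> = \<epsilon> * (fx k + gz k + (K - opt) / \<epsilon> * \<rho>)"
      using \<open>\<epsilon> > 0\<close> by (simp add: distrib_left)
    finally have "\<epsilon> * opt \<le> \<epsilon> * (fx k + gz k + (K - opt) / \<epsilon> * \<rho>)" .
    then have "opt \<le> fx k + gz k + (K - opt) / \<epsilon> * \<rho>"
      using \<open>\<epsilon> > 0\<close> by (simp add: mult_le_cancel_left_pos)
    then show ?thesis
      using 1 2 by (simp add: C_def \<rho>_def[symmetric] algebra_simps)
  qed
  have "(\<lambda>k. opt - (C * norm (r k) + \<beta> / 2 * (norm (r k))\<^sup>2)) \<longlonglongrightarrow>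
      opt - (C * norm (0 :: real^'p) + \<beta> / 2 * (norm (0 :: real^'p))\<^sup>2)"
    by (intro tendsto_intros r_tendsto_0')
  then have "(\<lambda>k. opt - (C * norm (r k) + \<beta> / 2 * (norm (r k))\<^sup>2)) \<longlonglongrightarrow> opt"
    by simp
  from tendsto_sandwich[OF _ _ this tendsto_const] show ?thesis
    using lower lag_le_opt by (simp add: always_eventually)
qed

text \<open>A fixed nearly optimal feasible point is close to all late iterates, by \<open>lag_growth\<close>.\<close>

lemma convergent_x: "convergent x"
proof (rule Cauchy_convergent, rule metric_CauchyI)
  fix e :: real assume "e > 0"
  define \<delta> where "\<delta> = \<kappa> * e\<^sup>2 / 16"
  have \<delta>: "\<delta> > 0" using \<open>e > 0\<close> \<kappa>_pos by (simp add: \<delta>_def)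
  have "(INF p. cost f g A B b p) < ereal (opt + \<delta>)"
    using \<delta> by (simp add: INF_cost)
  then obtain x' z' where lt: "cost f g A B b (x', z') < ereal (opt + \<delta>)"
    by (auto simp: INF_less_iff)
  then have eq: "A *v x' + B *v z' = b" and "f x' + g z' < ereal (opt + \<delta>)"
    by (auto simp: cost_def split: if_splits)
  then obtain a q where aq: "f x' = ereal a" "g z' = ereal q" "a + q < opt + \<delta>"
    using f_bot[of x'] g_bot[of z'] by (cases "f x'"; cases "g z'") auto
  obtain q' where q': "epicomp B g (B *v z') = ereal q'" "q' \<le> q"
    using epicomp_le[of B g z'] sc_bot(3)[OF sc params, of "B *v z'"] aq
    by (cases "epicomp B g (B *v z')") auto
  obtain n where n: "\<And>k. k \<ge> n \<Longrightarrow> opt - \<delta> < lag k"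
    using order_tendstoD(1)[OF lag_tendsto_opt, of "opt - \<delta>"] \<delta>
    by (auto simp: eventually_sequentially)
  have close: "norm (x' - x k) < e / 2" if "k \<ge> n" for k
  proof -
    have "lag k + \<kappa> / 2 * (norm (x' - x k))\<^sup>2 \<le> a + q'"
      using lag_growth[OF aq(1) q'(1), of k] eq by simp
    then have "\<kappa> / 2 * (norm (x' - x k))\<^sup>2 < \<kappa> / 2 * (e / 2)\<^sup>2"
      using aq(3) q'(2) n[OF that] by (simp add: \<delta>_def power_divide)
    then have "(norm (x' - x k))\<^sup>2 < (e / 2)\<^sup>2"
      using \<kappa>_pos by simp
    then show ?thesis
      using \<open>e > 0\<close> by (intro power2_less_imp_less[of _ "e / 2"]) auto
  qed
  have "dist (x j) (x k) < e" if "j \<ge> n" "k \<ge> n" for j k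
    using dist_triangle_half_l[of "x j" x' e "x k"] close that
    by (simp add: dist_norm norm_minus_commute)
  then show "\<exists>n. \<forall>j\<ge>n. \<forall>k\<ge>n. dist (x j) (x k) < e" by blast
qed

lemma convergent_Ax: "convergent (\<lambda>k. A *v x k)"
  and convergent_Bz: "convergent (\<lambda>k. B *v z k)"
proof -
  obtain xl where "x \<longlonglongrightarrow> xl"
    using convergent_x by (auto simp: convergent_def)
  then have Ax: "(\<lambda>k. A *v x k) \<longlonglongrightarrow> A *v xl"
    by (rule bounded_linear.tendsto[OF matrix_vector_mul_bounded_linear])
  then show "convergent (\<lambda>k. A *v x k)" by (rule convergentI)
  have "B *v z k = r k + b - A *v x k" for k
    by (simp add: r_def resid_def)
  moreover have "(\<lambda>k. r k + b - A *v x k) \<longlonglongrightarrow> 0 + b - A *v xl"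
    by (intro tendsto_intros r_tendsto_0' Ax)
  ultimately show "convergent (\<lambda>k. B *v z k)"
    by (auto intro: convergentI)
qed

lemma interior_locally_bounded_T:
  assumes "b \<in> interior (image_dom_sum f g A B)"
  shows "\<exists>\<epsilon>>0. \<exists>K. \<forall>e. norm e \<le> \<epsilon> \<longrightarrow> (b + e, K) \<in> T"
proof -
  obtain \<epsilon>0 where "\<epsilon>0 > 0" and \<epsilon>0: "cball b \<epsilon>0 \<subseteq> image_dom_sum f g A B"
    using assms by (auto simp: mem_interior_cball)
  show ?thesis
  proof (rule locally_bounded_T[OF subspace_UNIV \<open>\<epsilon>0 > 0\<close>])
    show "b + e \<in> image_dom_sum f g A B" if "norm e \<le> \<epsilon>0" for e
      using \<epsilon>0 that by (auto simp: dist_norm)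
  next
    fix \<epsilon> K assume "\<epsilon> > 0" "\<And>e. e \<in> UNIV \<Longrightarrow> norm e \<le> \<epsilon> \<Longrightarrow> (b + e, K) \<in> T"
    then show ?thesis by blast
  qed
qed

lemma direction_point:
  fixes u :: "real^'p"
  assumes "\<epsilon> > 0" "\<And>e. norm e \<le> \<epsilon> \<Longrightarrow> (b + e, K) \<in> T"
  obtains e where "(b + e, K) \<in> T" "u \<bullet> e = - (\<epsilon> * norm u)"
proof
  \<comment> \<open>for \<open>u = 0\<close> this is \<open>0\<close>, which serves as well\<close>
  define e where "e = (- \<epsilon> / norm u) *\<^sub>R u"
  show "(b + e, K) \<in> T"
    using assms by (intro assms(2)) (auto simp: e_def)
  show "u \<bullet> e = - (\<epsilon> * norm u)"
    by (simp add: e_def flip: power2_norm_eq_inner) (simp add: power2_eq_square)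
qed

text \<open>Testing \<open>lag_le_of_mem\<close> at a perturbation of length \<open>\<epsilon>\<close> opposite to \<open>w k\<close> bounds its norm.\<close>

lemma interior_bounded_y:
  assumes "b \<in> interior (image_dom_sum f g A B)"
  shows "bounded (range y)"
proof -
  obtain \<epsilon> K where "\<epsilon> > 0" and K: "\<And>e. norm e \<le> \<epsilon> \<Longrightarrow> (b + e, K) \<in> T"
    using interior_locally_bounded_T[OF assms] by blast
  obtain R where R: "\<And>k. norm (r k) \<le> R"
    using convergent_imp_bounded[OF r_tendsto_0'] unfolding bounded_iff by blast
  have "norm (y k) \<le> (K - lag 0) / \<epsilon> + \<beta> * R" for k
  proof -
    obtain e where e: "(b + e, K) \<in> T" "w k \<bullet> e = - (\<epsilon> * norm (w k))"
      by (rule direction_point[OF \<open>\<epsilon> > 0\<close> K])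
    have "lag 0 + \<epsilon> * norm (w k) \<le> K"
      using lag_le_of_mem[OF e(1), of k] lag_mono[of 0 k] e(2) by simp
    then have "norm (w k) \<le> (K - lag 0) / \<epsilon>"
      using \<open>\<epsilon> > 0\<close> by (simp add: pos_le_divide_eq mult.commute)
    moreover have "norm (y k) \<le> norm (w k) + norm (\<beta> *\<^sub>R r k)"
      using norm_triangle_ineq4[of "w k" "\<beta> *\<^sub>R r k"] by (simp add: w_def)
    moreover have "norm (\<beta> *\<^sub>R r k) \<le> \<beta> * R"
      using R[of k] \<beta>_pos by simp
    ultimately show ?thesis by linarith
  qed
  then show ?thesis by (rule boundedI_seq)
qed

lemma interior_bounded_z:
  assumes int: "b \<in> interior (image_dom_sum f g A B)"
    and lev: "level_bounded (\<lambda>w. max (g w) (ereal (norm (B *v w))))"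
  shows "bounded (range z)"
proof -
  obtain K1 where K1: "\<And>k. norm (A *v x k) \<le> K1"
    using convergent_imp_Bseq[OF convergent_Ax] unfolding Bseq_eq_bounded bounded_iff by blast
  obtain K2 where K2: "\<And>k. norm (B *v z k) \<le> K2"
    using convergent_imp_Bseq[OF convergent_Bz] unfolding Bseq_eq_bounded bounded_iff by blast
  obtain K3 where K3: "\<And>k. norm (y k) \<le> K3"
    using interior_bounded_y[OF int] unfolding bounded_iff by blast
  obtain K4 where K4: "\<And>k. norm (r k) \<le> K4"
    using convergent_imp_bounded[OF r_tendsto_0'] unfolding bounded_iff by blast
  define C where "C = opt - fx 0 + K3 * (K1 + K1) + K3 * K4"
  have "gz k \<le> C" for k
  proof -
    have "0 \<le> \<mu> / 2 * (norm (x k - x 0))\<^sup>2"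
      using sc_pos(1)[OF sc params] by simp
    then have "fx 0 \<le> fx k + y 0 \<bullet> (A *v x k - A *v x 0)"
      using x_growth[OF sc params quad_min_x f_x f_x, of 0 k] by simp
    moreover have "y 0 \<bullet> (A *v x k - A *v x 0) \<le> K3 * (K1 + K1)"
    proof -
      have "norm (A *v x k - A *v x 0) \<le> K1 + K1"
        using norm_triangle_ineq4[of "A *v x k" "A *v x 0"] K1[of k] K1[of 0] by simp
      then have "norm (y 0) * norm (A *v x k - A *v x 0) \<le> K3 * (K1 + K1)"
        using K3[of 0] by (intro mult_mono) (auto intro: order_trans[OF norm_ge_zero])
      with norm_cauchy_schwarz show ?thesis by (rule order_trans)
    qed
    moreover have "- (y k \<bullet> r k) \<le> K3 * K4"
    proof -
      have "- (y k \<bullet> r k) \<le> norm (y k) * norm (r k)"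
        using norm_cauchy_schwarz[of "- y k" "r k"] by simp
      also have "\<dots> \<le> K3 * K4"
        using K3[of k] K4[of k] by (intro mult_mono) (auto intro: order_trans[OF norm_ge_zero])
      finally show ?thesis .
    qed
    moreover have "0 \<le> \<beta> / 2 * (norm (r k))\<^sup>2"
      using \<beta>_pos by simp
    ultimately show ?thesis
      using lag_le_opt[of k] unfolding lag_def C_def by linarith
  qed
  then have "gz k \<le> max C K2" "norm (B *v z k) \<le> max C K2" for k
    using K2[of k] by (auto intro: order_trans[OF _ max.cobounded1] order_trans[OF _ max.cobounded2])
  then have "max (g (z k)) (ereal (norm (B *v z k))) \<le> ereal (max C K2)" for k
    unfolding g_z by (intro max.boundedI) (simp_all only: ereal_less_eq)
  then have "range z \<subseteq> {w. max (g w) (ereal (norm (B *v w))) \<le> ereal (max C K2)}"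
    by blast
  moreover have "bounded {w. max (g w) (ereal (norm (B *v w))) \<le> ereal (max C K2)}"
    using lev unfolding level_bounded_def by blast
  ultimately show ?thesis
    by (rule bounded_subset[rotated])
qed

text \<open>An interior \<open>b\<close> allows perturbations opposite to any dual point, so that the dual cost grows
  linearly. Otherwise, since \<open>b\<close> is a relative interior point, the affine hull is a proper
  affine subspace, and the dual cost stays bounded above along a line orthogonal to it. The line passes
  through the multiplier \<open>w 0\<close>, where the dual cost is known to be finite.\<close>

lemma interior_iff_dual_level_bounded:
  "b \<in> interior (image_dom_sum f g A B) \<longleftrightarrow> level_bounded (dual_cost f g A B b)"
proof
  assume int: "b \<in> interior (image_dom_sum f g A B)"
  obtain \<epsilon> K where "\<epsilon> > 0" and K: "\<And>e. norm e \<le> \<epsilon> \<Longrightarrow> (b + e, K) \<in> T"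
    using interior_locally_bounded_T[OF int] by blast
  show "level_bounded (dual_cost f g A B b)"
    unfolding level_bounded_def
  proof
    fix l :: real
    have "norm u \<le> (l + K) / \<epsilon>" if "dual_cost f g A B b u \<le> ereal l" for u
    proof -
      obtain e where e: "(b + e, K) \<in> T" "u \<bullet> e = - (\<epsilon> * norm u)"
        by (rule direction_point[OF \<open>\<epsilon> > 0\<close> K])
      have "ereal (- (u \<bullet> (b + e - b)) - K) \<le> dual_cost f g A B b u"
        by (rule dual_cost_ge[OF e(1) sc_bot(1,3)[OF sc params]])
      then have "ereal (- (u \<bullet> (b + e - b)) - K) \<le> ereal l"
        using that by (rule order_trans)
      then show ?thesis
        using e(2) \<open>\<epsilon> > 0\<close> by (simp add: pos_le_divide_eq mult.commute)
    qed
    then show "bounded {u. dual_cost f g A B b u \<le> ereal l}"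
      unfolding bounded_iff by blast
  qed
next
  assume lev: "level_bounded (dual_cost f g A B b)"
  let ?S = "image_dom_sum f g A B"
  show "b \<in> interior ?S"
  proof (rule ccontr)
    assume not: "b \<notin> interior ?S"
    have "shifts \<noteq> UNIV"
    proof
      assume "shifts = UNIV"
      then have "s \<in> affine hull ?S" for s
        unfolding shifts_def by (metis UNIV_I add_diff_cancel_left' diff_add_cancel mem_Collect_eq add.commute)
      then have "rel_interior ?S = interior ?S"
        by (intro rel_interior_interior) auto
      then show False
        using not sc by (simp add: strongly_convex_case_def)
    qed
    then have "span shifts \<noteq> UNIV"
      using subspace_shifts by (metis span_eq_iff)
    then obtain u where u: "u \<noteq> 0" "\<And>e. e \<in> shifts \<Longrightarrow> u \<bullet> e = 0"
      using span_not_univ_subset_hyperplane[of shifts] span_superset[of shifts] by blast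
    have orth: "u \<bullet> (A *v x' + B *v z' - b) = 0" if "f x' = ereal a" "g z' = ereal q" for x' z' a q
    proof (rule u(2))
      have "A *v x' + B *v z' \<in> ?S"
        using that by (rule image_dom_sumI)
      then show "A *v x' + B *v z' - b \<in> shifts"
        by (simp add: shifts_def hull_inc)
    qed
    define K where "K = 2 * (- lag 0) + fx 0 + gz 0 + w 0 \<bullet> r 0"
    have le: "dual_cost f g A B b (w 0 + s *\<^sub>R u) \<le> ereal K" for s
    proof -
      have "dual_cost f g A B b (w 0 + s *\<^sub>R u) \<le> ereal (2 * (- lag 0) + fx 0 + gz 0
          + (w 0 + s *\<^sub>R u) \<bullet> (A *v x 0 + B *v z 0 - b))"
      proof (rule dual_cost_le[where f = f and g = g, OF _ f_bot g_bot f_x g_z])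
        fix x' z' a q assume aq: "f x' = ereal a" "g z' = ereal q"
        have "lag 0 - w 0 \<bullet> (A *v x' + B *v z' - b) \<le> a + q"
          by (rule lag_le_of_mem[OF mem_T_point[OF aq]])
        then show "- ((w 0 + s *\<^sub>R u) \<bullet> (A *v x' + B *v z' - b)) - a - q \<le> - lag 0"
          using orth[OF aq] by (simp add: inner_add_left)
      qed
      also have "(w 0 + s *\<^sub>R u) \<bullet> (A *v x 0 + B *v z 0 - b) = w 0 \<bullet> r 0"
        using orth[of "x 0" "fx 0" "z 0" "gz 0"] by (simp add: f_x g_z inner_add_left r_def resid_def)
      finally show ?thesis by (simp add: K_def)
    qed
    have "bounded {u. dual_cost f g A B b u \<le> ereal K}"
      using lev unfolding level_bounded_def by blast
    then obtain R where R: "\<And>s. norm (w 0 + s *\<^sub>R u) \<le> R"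
      using le unfolding bounded_iff by blast
    have "\<bar>s\<bar> * norm u \<le> R + norm (w 0)" for s
      using R[of s] norm_triangle_ineq4[of "w 0 + s *\<^sub>R u" "w 0"] by simp
    \<comment> \<open>a parameter that moves the point out of the ball of radius \<open>R\<close>\<close>
    from this[of "(\<bar>R\<bar> + norm (w 0) + 1) / norm u"] show False
      using u(1) by (simp add: abs_divide)
  qed
qed

end

lemma strongly_convex_case_result:
  assumes sc: "strongly_convex_case f g A B b \<mu>" and params: "strongly_convex_params f A \<mu> lam \<beta> c"
    and run: "ls_admm_run f g A B b (-1) lam \<beta> c imax 0 xm ym zm x y z"
  shows "summable (\<lambda>k. (norm (resid A B b (x k) (z k)))\<^sup>2) \<and>
        incseq (\<lambda>k. aug_lag f g A B b \<beta> (x k) (z k) (y k)) \<and>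
        (\<lambda>k. aug_lag f g A B b \<beta> (x k) (z k) (y k)) \<longlonglongrightarrow> (INF p. cost f g A B b p) \<and>
        convergent (\<lambda>k. A *v x k) \<and> convergent (\<lambda>k. B *v z k) \<and>
        (lsc g \<longrightarrow>
          (\<forall>xc yc zc. cluster_point (\<lambda>k. (x k, y k, z k)) (xc, yc, zc) \<longrightarrow>
             kkt f g A B b xc yc zc)) \<and>
        (b \<in> interior (image_dom_sum f g A B) \<longleftrightarrow> level_bounded (dual_cost f g A B b)) \<and>
        (b \<in> interior (image_dom_sum f g A B) \<longrightarrow>
           bounded (range (\<lambda>k. (x k, y k, B *v z k))) \<and>
           (level_bounded (\<lambda>w. max (g w) (ereal (norm (B *v w)))) \<longrightarrow>
              bounded (range (\<lambda>k. (x k, y k, z k)))))"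
proof -
  interpret dual_admm_descent f g A B b \<beta> c x y z \<mu> lam
  proof
    show "\<exists>yt zt. (x k, y k, z k) \<in> admm f g A B b \<beta> yt zt" for k
      by (rule ls_admm_run_admm[OF run])
    show "ls_accept f g A B b (- 1) \<beta> c (x k, y k, z k) (x (Suc k), y (Suc k), z (Suc k))" for k
      by (rule ls_admm_run_accept[OF run sc_pos(2)[OF sc params] sc_nominal[OF sc params]])
  qed (use sc params sc_bot[OF sc params] sc_pos[OF sc params] in auto)
  have bx: "bounded (range x)" and bBz: "bounded (range (\<lambda>k. B *v z k))"
    using convergent_imp_Bseq[OF convergent_x] convergent_imp_Bseq[OF convergent_Bz]
    by (simp_all add: Bseq_eq_bounded)
  show ?thesis
  proof (intro conjI impI allI)
    show "summable (\<lambda>k. (norm (resid A B b (x k) (z k)))\<^sup>2)"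
      using summable_r by (simp add: r_def)
    show "incseq (\<lambda>k. aug_lag f g A B b \<beta> (x k) (z k) (y k))"
      using lag_mono by (simp add: incseq_def aug_lag_eq)
    show "(\<lambda>k. aug_lag f g A B b \<beta> (x k) (z k) (y k)) \<longlonglongrightarrow> (INF p. cost f g A B b p)"
      using lag_tendsto_opt by (simp add: INF_cost aug_lag_eq)
    show "kkt f g A B b xc yc zc"
      if "lsc g" "cluster_point (\<lambda>k. (x k, y k, z k)) (xc, yc, zc)" for xc yc zc
      using sc that by (intro cluster_point_kkt(1) r_tendsto_0') (simp_all add: strongly_convex_case_def)
    show "bounded (range (\<lambda>k. (x k, y k, B *v z k)))" if "b \<in> interior (image_dom_sum f g A B)"
      by (intro bounded_seq_Pair bx bBz interior_bounded_y that)
    show "bounded (range (\<lambda>k. (x k, y k, z k)))" if "b \<in> interior (image_dom_sum f g A B)"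
      "level_bounded (\<lambda>w. max (g w) (ereal (norm (B *v w))))"
      by (intro bounded_seq_Pair bx interior_bounded_y interior_bounded_z that)
  qed (rule convergent_Ax convergent_Bz interior_iff_dual_level_bounded)+
qed

section \<open>Convergence of ADMM with linesearch\<close>

theorem theorem4p4:
  fixes f :: "real^'m \<Rightarrow> ereal" and g :: "real^'n \<Rightarrow> ereal"
    and A :: "real^'m^'p" and B :: "real^'n^'p" and b :: "real^'p"
    and L \<mu> lam \<beta> c :: real and imax :: enat
    and xm :: "real^'m" and ym :: "real^'p" and zm :: "real^'n"
    and x :: "nat \<Rightarrow> real^'m" and y :: "nat \<Rightarrow> real^'p" and z :: "nat \<Rightarrow> real^'n"
  shows
    "(smooth_case f g A B b L \<and> smooth_params f A L lam \<beta> c \<and>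
      ls_admm_run f g A B b 1 lam \<beta> c imax 0 xm ym zm x y z \<longrightarrow>
        summable (\<lambda>k. (norm (resid A B b (x k) (z k)))\<^sup>2) \<and>
        (\<exists>l::real.
           (\<lambda>k. aug_lag f g A B b \<beta> (x k) (z k) (y k)) \<longlonglongrightarrow> ereal l \<and>
           (lsc f \<and> lsc g \<longrightarrow>
             (\<forall>xc yc zc. cluster_point (\<lambda>k. (x k, y k, z k)) (xc, yc, zc) \<longrightarrow>
                kkt f g A B b xc yc zc \<and> f xc + g zc = ereal l))) \<and>
        (level_bounded (cost f g A B b) \<longrightarrow>
           bounded (range (\<lambda>k. (A *v x k, y k, B *v z k))) \<and>
           ((\<exists>Lf. lipschitz_gradient Lf f) \<longrightarrow> bounded (range (\<lambda>k. (x k, y k, z k))))))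
     \<and>
     (strongly_convex_case f g A B b \<mu> \<and> strongly_convex_params f A \<mu> lam \<beta> c \<and>
      ls_admm_run f g A B b (-1) lam \<beta> c imax 0 xm ym zm x y z \<longrightarrow>
        summable (\<lambda>k. (norm (resid A B b (x k) (z k)))\<^sup>2) \<and>
        incseq (\<lambda>k. aug_lag f g A B b \<beta> (x k) (z k) (y k)) \<and>
        (\<lambda>k. aug_lag f g A B b \<beta> (x k) (z k) (y k)) \<longlonglongrightarrow> (INF p. cost f g A B b p) \<and>
        convergent (\<lambda>k. A *v x k) \<and> convergent (\<lambda>k. B *v z k) \<and>
        (lsc g \<longrightarrow>
          (\<forall>xc yc zc. cluster_point (\<lambda>k. (x k, y k, z k)) (xc, yc, zc) \<longrightarrow>
             kkt f g A B b xc yc zc)) \<and>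
        (b \<in> interior (image_dom_sum f g A B) \<longleftrightarrow> level_bounded (dual_cost f g A B b)) \<and>
        (b \<in> interior (image_dom_sum f g A B) \<longrightarrow>
           bounded (range (\<lambda>k. (x k, y k, B *v z k))) \<and>
           (level_bounded (\<lambda>w. max (g w) (ereal (norm (B *v w)))) \<longrightarrow>
              bounded (range (\<lambda>k. (x k, y k, z k))))))"
  using smooth_case_result[of f g A B b L lam \<beta> c imax xm ym zm x y z]
    strongly_convex_case_result[of f g A B b \<mu> lam \<beta> c imax xm ym zm x y z]
  by blast

end
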